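(* Every co-context-free group has a decidable knapsack problem.
   Context: Let $G$ be a group with finite generating set $\Sigma$ and let $h:(\Sigma\cup\Sigma^{-1})^*\to G$ be the canonical monoid homomorphism. The co-word problem of $G$ with respect to $\Sigma\cup\Sigma^{-1}$ is the language $\{w\in(\Sigma\cup\Sigma^{-1})^*\mid h(w)\neq1\}$. A finitely generated group $G$ is co-context-free if its co-word problem is a context-free language (i.e., generated by a context-free grammar); this property does not depend on the chosen finite generating set. Elements of $G$ are represented by finite words over $\Sigma\cup\Sigma^{-1}$. The knapsack problem for $G$ is the decision problem: given $g_1,\ldots,g_k,g\in G$ ($k$ is part of the input), decide whether there exist natural numbers $e_1,\ldots,e_k\geq0$ such that $g=g_1^{e_1}\cdots g_k^{e_k}$ in $G$. *)

theory Defs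
  imports "HOL-Algebra.Algebra" "HOL-Library.Nat_Bijection"
begin

section \<open>Computability\<close>

text \<open>
  \<open>general_recursive n f\<close>: the function \<open>f\<close>, restricted to argument lists of length \<open>n\<close>, is
  a total \<open>n\<close>-ary recursive function (its values on lists of other lengths are irrelevant).
  Minimization is only allowed where a zero exists for all arguments, so that every function
  in the class is total and \<open>LEAST\<close> is always meaningful.
\<close>

inductive general_recursive :: "nat \<Rightarrow> (nat list \<Rightarrow> nat) \<Rightarrow> bool" where
  zero: "general_recursive n (\<lambda>xs. 0)"
| succ: "general_recursive 1 (\<lambda>xs. Suc (xs ! 0))"
| proj: "i < n \<Longrightarrow> general_recursive n (\<lambda>xs. xs ! i)"
| comp: "general_recursive (length gs) f \<Longrightarrow> (\<forall>g \<in> set gs. general_recursive n g) \<Longrightarrow>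
    general_recursive n (\<lambda>xs. f (map (\<lambda>g. g xs) gs))"
| prim_rec: "general_recursive n f \<Longrightarrow> general_recursive (Suc (Suc n)) g \<Longrightarrow>
    general_recursive (Suc n)
      (\<lambda>xs. rec_nat (f (tl xs)) (\<lambda>y r. g (y # r # tl xs)) (hd xs))"
| minimize: "general_recursive (Suc n) f \<Longrightarrow>
    (\<forall>xs. length xs = n \<longrightarrow> (\<exists>y. f (y # xs) = 0)) \<Longrightarrow>
    general_recursive n (\<lambda>xs. LEAST y. f (y # xs) = 0)"

definition decidable_set :: "nat set \<Rightarrow> bool" where
  "decidable_set A \<longleftrightarrow>
    (\<exists>f. general_recursive 1 f \<and> (\<forall>x. f [x] = (if x \<in> A then 1 else 0)))"


section \<open>Context-free languages\<close>

datatype ('n, 't) symbol = Nonterminal 'n | Terminal 't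

type_synonym ('n, 't) productions = "('n \<times> ('n, 't) symbol list) set"

inductive derives1 ::
  "('n, 't) productions \<Rightarrow> ('n, 't) symbol list \<Rightarrow> ('n, 't) symbol list \<Rightarrow> bool"
  for P where
  "(A, \<alpha>) \<in> P \<Longrightarrow> derives1 P (u @ [Nonterminal A] @ v) (u @ \<alpha> @ v)"

definition language_of :: "('n, 't) productions \<Rightarrow> 'n \<Rightarrow> 't list set" where
  "language_of P S = {w. (derives1 P)\<^sup>*\<^sup>* [Nonterminal S] (map Terminal w)}"

text \<open>
  A grammar is given by its finite set of productions and its start symbol. As only finitely many
  nonterminals occur in a grammar, taking them to be natural numbers is no restriction.
\<close>

definition context_free :: "'t list set \<Rightarrow> bool" where
  "context_free L \<longleftrightarrow>
    (\<exists>(P :: (nat, 't) productions) S. finite P \<and> L = language_of P S)"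


section \<open>Words over a generating set\<close>

definition finite_generating_set :: "('a, 'b) monoid_scheme \<Rightarrow> 'a set \<Rightarrow> bool" where
  "finite_generating_set G \<Sigma> \<longleftrightarrow> finite \<Sigma> \<and> \<Sigma> \<subseteq> carrier G \<and> generate G \<Sigma> = carrier G"

text \<open>The alphabet \<open>\<Sigma> \<union> \<Sigma>\<^sup>-\<^sup>1\<close>, where \<open>\<Sigma>\<^sup>-\<^sup>1\<close> consists of the inverses in the group.\<close>

definition sym_alphabet :: "('a, 'b) monoid_scheme \<Rightarrow> 'a set \<Rightarrow> 'a set" where
  "sym_alphabet G \<Sigma> = \<Sigma> \<union> m_inv G ` \<Sigma>"

text \<open>The canonical homomorphism from words to the group.\<close>

definition word_val :: "('a, 'b) monoid_scheme \<Rightarrow> 'a list \<Rightarrow> 'a" where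
  "word_val G w = foldr (\<otimes>\<^bsub>G\<^esub>) w \<one>\<^bsub>G\<^esub>"

definition co_word_problem :: "('a, 'b) monoid_scheme \<Rightarrow> 'a set \<Rightarrow> 'a list set" where
  "co_word_problem G \<Sigma> = {w \<in> lists (sym_alphabet G \<Sigma>). word_val G w \<noteq> \<one>\<^bsub>G\<^esub>}"

definition co_context_free_group :: "('a, 'b) monoid_scheme \<Rightarrow> bool" where
  "co_context_free_group G \<longleftrightarrow> group G \<and>
    (\<exists>\<Sigma>. finite_generating_set G \<Sigma> \<and> context_free (co_word_problem G \<Sigma>))"


section \<open>The knapsack problem\<close>

text \<open>An instance is a list of words \<open>g\<^sub>1, \<dots>, g\<^sub>k\<close> (of arbitrary length \<open>k\<close>) together with a word \<open>g\<close>.\<close>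

definition knapsack_solvable ::
  "('a, 'b) monoid_scheme \<Rightarrow> 'a list list \<Rightarrow> 'a list \<Rightarrow> bool" where
  "knapsack_solvable G us v \<longleftrightarrow>
    (\<exists>es :: nat list. length es = length us \<and>
      word_val G v =
        foldr (\<otimes>\<^bsub>G\<^esub>) (map2 (\<lambda>u e. word_val G u [^]\<^bsub>G\<^esub> e) us es) \<one>\<^bsub>G\<^esub>)"

definition knapsack_problem ::
  "('a, 'b) monoid_scheme \<Rightarrow> 'a set \<Rightarrow> ('a list list \<times> 'a list) set" where
  "knapsack_problem G \<Sigma> =
    {(us, v). us \<in> lists (lists (sym_alphabet G \<Sigma>)) \<and> v \<in> lists (sym_alphabet G \<Sigma>) \<and>
      knapsack_solvable G us v}"

text \<open>Instances as natural numbers, relative to a numbering \<open>c\<close> of the letters.\<close>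

definition encode_instance :: "('a \<Rightarrow> nat) \<Rightarrow> 'a list list \<times> 'a list \<Rightarrow> nat" where
  "encode_instance c = (\<lambda>(us, v).
    prod_encode (list_encode (map (\<lambda>u. list_encode (map c u)) us), list_encode (map c v)))"

text \<open>
  The problem is required to be decidable for every finite generating set and every injective
  numbering of the alphabet.
\<close>

definition decidable_knapsack :: "('a, 'b) monoid_scheme \<Rightarrow> bool" where
  "decidable_knapsack G \<longleftrightarrow>
    (\<forall>\<Sigma> c. finite_generating_set G \<Sigma> \<longrightarrow> inj_on c (sym_alphabet G \<Sigma>) \<longrightarrow>
      decidable_set (encode_instance c ` knapsack_problem G \<Sigma>))"

end

(*
  For an instance g_1, ..., g_k, g the exponent vectors that do NOT solve it form the set
  M = {x. g^-1 g_1^x_1 ... g_k^x_k lies in the co-word problem}, so the instance is solvable iff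
  M is not all of N^k. Intersecting the grammar of the co-word problem with an automaton for
  g^-1 g_1^* ... g_k^* turns M into the weight vectors of a commutative grammar. By an Euler-type
  argument, counts of rule applications come from a derivation iff they are balanced at every
  nonterminal and all used rules are reachable; hence M is a finite union of sets
  {x. c + A m = x for some m}. Solving such systems digit by digit in base two, the carries stay
  bounded, so M has only finitely many iterated residuals {x. d + 2 x in M} with d in {0,1}^k,
  their number being bounded by an explicit function of the instance. If x is a vector outside M
  with fewest binary digits, no residual needs to occur twice along the digits of x, so a solvable
  instance has a solution below an explicit computable bound. It remains to search below this bound
  and to test membership in the co-word problem: a word is generated iff the fact saying so lies in
  every set of facts closed under the productions.
*)
theory Submission
  imports Defs "HOL-Library.Sublist"
begin

section \<open>Closure properties of the total recursive functions, and Cantor pairing\<close>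

section \<open>Recursive functions\<close>

text \<open>The obstacle is the complement. That an exponent vector lies in M is an existential
  statement: some multiplicities of rules work. Solvability asks for a vector outside M, and a
  negated existential gives no bound on the search. A finite family of sets closed under residuals
  gets around this: the argument for points outside a member uses the family alone, so no complement
  is ever described. The price is that a residual of one solution set is a union of several; all
  such unions must be counted, which makes the bound a tower of powers of two. Reachability of the
  used rules is not a linear condition. It is handled by fixing the set of used rules in advance;
  one application of each is then absorbed into the constant c. The grammar and the translation of
  letters are fixed finite data, so it does not matter how they are found. Only the dependence on
  the instance must be computable; hence the sizes of the automaton and of the rule set are bounded
  by explicit functions of it. The grammar may belong to another generating set than the instance,
  so the letters of the instance are rewritten as words over the alphabet of the grammar.\<close>

definition recn :: "nat \<Rightarrow> (nat list \<Rightarrow> nat) \<Rightarrow> bool" where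
  "recn n F \<longleftrightarrow> (\<exists>g. general_recursive n g \<and> (\<forall>xs. length xs = n \<longrightarrow> g xs = F xs))"

lemma recnI: "general_recursive n F \<Longrightarrow> recn n F"
  unfolding recn_def by blast

text \<open>\<open>general_recursive\<close> speaks of functions on all lists, in the literal shape
  that its rules produce. \<open>recn\<close> forgets the values on lists of the wrong length, which
  makes this replacement possible.\<close>

lemma recn_cong: "recn n F \<Longrightarrow> (\<And>xs. length xs = n \<Longrightarrow> F xs = F' xs) \<Longrightarrow> recn n F'"
  unfolding recn_def by (elim exE, intro exI) auto

lemma recn_comp:
  assumes "recn (length Gs) F" "\<forall>G\<in>set Gs. recn n G"
  shows "recn n (\<lambda>xs. F (map (\<lambda>G. G xs) Gs))"
proof -
  obtain f where f: "general_recursive (length Gs) f" "\<And>xs. length xs = length Gs \<Longrightarrow> f xs = F xs"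
    using assms(1) unfolding recn_def by blast
  from assms(2) obtain h where h: "\<forall>G\<in>set Gs. general_recursive n (h G) \<and> (\<forall>xs. length xs = n \<longrightarrow> h G xs = G xs)"
    unfolding recn_def by metis
  have "general_recursive n (\<lambda>xs. f (map (\<lambda>g. g xs) (map h Gs)))"
    by (rule general_recursive.comp) (use f h in auto)
  moreover have "f (map (\<lambda>g. g xs) (map h Gs)) = F (map (\<lambda>G. G xs) Gs)" if "length xs = n" for xs
  proof -
    have "map (\<lambda>g. g xs) (map h Gs) = map (\<lambda>G. G xs) Gs"
      using h that by auto
    then show ?thesis using f(2) by (metis length_map)
  qed
  ultimately show ?thesis unfolding recn_def by blast
qed

lemma recn_comp1:
  assumes "recn 1 (\<lambda>ys. f (ys ! 0))" "recn n g"
  shows "recn n (\<lambda>xs. f (g xs))"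
  using recn_comp[of "[g]" "\<lambda>ys. f (ys ! 0)" n] assms by simp

lemma recn_comp2:
  assumes "recn 2 (\<lambda>ys. f (ys ! 0) (ys ! 1))" "recn n g" "recn n h"
  shows "recn n (\<lambda>xs. f (g xs) (h xs))"
  using recn_comp[of "[g, h]" "\<lambda>ys. f (ys ! 0) (ys ! 1)" n] assms by (simp add: numeral_2_eq_2)

lemma recn_proj: "i < n \<Longrightarrow> recn n (\<lambda>xs. xs ! i)"
  by (intro recnI general_recursive.proj)

lemma recn_Suc: "recn n f \<Longrightarrow> recn n (\<lambda>xs. Suc (f xs))"
  by (rule recn_comp1[OF recnI[OF general_recursive.succ]])

lemma recn_const: "recn n (\<lambda>xs. c)"
  by (induction c) (auto intro: recnI general_recursive.zero recn_Suc)

lemma recn_prim: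
  assumes "recn n f" "recn (Suc (Suc n)) g"
  shows "recn (Suc n) (\<lambda>xs. rec_nat (f (tl xs)) (\<lambda>y r. g (y # r # tl xs)) (hd xs))"
proof -
  obtain f' where f: "general_recursive n f'" "\<And>xs. length xs = n \<Longrightarrow> f' xs = f xs"
    using assms(1) unfolding recn_def by blast
  obtain g' where g: "general_recursive (Suc (Suc n)) g'" "\<And>xs. length xs = Suc (Suc n) \<Longrightarrow> g' xs = g xs"
    using assms(2) unfolding recn_def by blast
  have "rec_nat (f' (tl xs)) (\<lambda>y r. g' (y # r # tl xs)) m = rec_nat (f (tl xs)) (\<lambda>y r. g (y # r # tl xs)) m"
    if "length xs = Suc n" for xs m
    using that f g by (induction m) auto
  then show ?thesis
    using general_recursive.prim_rec[OF f(1) g(1)] unfolding recn_def by blast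
qed

lemma recn_minimize:
  assumes "recn (Suc n) f" "\<And>xs. length xs = n \<Longrightarrow> \<exists>y. f (y # xs) = 0"
  shows "recn n (\<lambda>xs. LEAST y. f (y # xs) = 0)"
proof -
  obtain g where g: "general_recursive (Suc n) g" "\<And>xs. length xs = Suc n \<Longrightarrow> g xs = f xs"
    using assms(1) unfolding recn_def by blast
  show ?thesis unfolding recn_def
    by (rule exI[of _ "\<lambda>xs. LEAST y. g (y # xs) = 0"])
      (use g assms in \<open>auto intro!: general_recursive.minimize\<close>)
qed

lemma recn_add: "recn 2 (\<lambda>xs. xs ! 0 + xs ! 1)"
proof -
  have pr: "recn (Suc 1) (\<lambda>xs. rec_nat ((\<lambda>ys. ys ! 0) (tl xs)) (\<lambda>y r. (\<lambda>zs. Suc (zs ! 1)) (y # r # tl xs)) (hd xs))"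
    by (intro recn_prim recn_Suc recn_proj) auto
  have h: "rec_nat a (\<lambda>y r. Suc r) m = m + a" for a m :: nat
    by (induction m) auto
  show ?thesis
    by (rule recn_cong[OF pr[folded One_nat_def, unfolded Suc_1]]) (auto simp: h[simplified] length_Suc_conv numeral_2_eq_2)
qed

lemma recn_diff: "recn 2 (\<lambda>xs. xs ! 0 - xs ! 1)"
proof -
  have pr: "recn (Suc 0) (\<lambda>xs. rec_nat ((\<lambda>ys. 0) (tl xs)) (\<lambda>y r. (\<lambda>zs. zs ! 0) (y # r # tl xs)) (hd xs))"
    by (intro recn_prim recn_const recn_proj) auto
  have h: "rec_nat 0 (\<lambda>y r. y) m = m - 1" for m :: nat
    by (induction m) auto
  have P: "recn 1 (\<lambda>xs. xs ! 0 - 1)"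
    by (rule recn_cong[OF pr[folded One_nat_def]]) (auto simp: length_Suc_conv, auto simp: h[simplified])
  have pr: "recn (Suc 1) (\<lambda>xs. rec_nat ((\<lambda>ys. ys ! 0) (tl xs)) (\<lambda>y r. (\<lambda>zs. zs ! 1 - 1) (y # r # tl xs)) (hd xs))"
    by (intro recn_prim recn_comp1[OF P] recn_proj) auto
  have h: "rec_nat a (\<lambda>y r. r - 1) m = a - m" for a m :: nat
    by (induction m) auto
  have r2: "recn 2 (\<lambda>xs. xs ! 1 - xs ! 0)"
    by (rule recn_cong[OF pr[folded One_nat_def, unfolded Suc_1]]) (auto simp: h[simplified] length_Suc_conv numeral_2_eq_2)
  \<comment> \<open>Primitive recursion runs over the first argument, so iterating the predecessor
    subtracts the first argument from the second. Projections swap them back.\<close>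
  from recn_comp2[OF r2, of 2 "\<lambda>xs. xs ! 1" "\<lambda>xs. xs ! 0"] show ?thesis
    by (simp add: recn_proj)
qed

lemma recn_triangle: "recn 1 (\<lambda>xs. triangle (xs ! 0))"
proof -
  have pr: "recn (Suc 0) (\<lambda>xs. rec_nat ((\<lambda>ys. 0) (tl xs)) (\<lambda>y r. (\<lambda>zs. zs ! 1 + Suc (zs ! 0)) (y # r # tl xs)) (hd xs))"
    by (intro recn_prim recn_const recn_Suc recn_proj recn_comp2[OF recn_add]) auto
  have h: "rec_nat 0 (\<lambda>y r. r + Suc y) m = triangle m" for m :: nat
    by (induction m) auto
  show ?thesis
    by (rule recn_cong[OF pr[folded One_nat_def]]) (auto simp: length_Suc_conv, auto simp: h[simplified])
qed

lemma recn_prod_encode: "recn 2 (\<lambda>xs. prod_encode (xs ! 0, xs ! 1))"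
  unfolding prod_encode_def prod.case
  by (intro recn_comp2[OF recn_add] recn_comp1[OF recn_triangle] recn_proj) auto

definition pfst :: "nat \<Rightarrow> nat" where "pfst p = fst (prod_decode p)"
definition psnd :: "nat \<Rightarrow> nat" where "psnd p = snd (prod_decode p)"

lemma pfst_encode [simp]: "pfst (prod_encode (x, y)) = x" 
  and psnd_encode [simp]: "psnd (prod_encode (x, y)) = y"
  and pair_pfst_psnd [simp]: "prod_encode (pfst p, psnd p) = p"
  by (simp_all add: pfst_def psnd_def)

text \<open>\<open>prod_encode (m, n) = triangle (m + n) + m\<close> lies in the interval between the
  triangular numbers of \<open>m + n\<close> and \<open>m + n + 1\<close>.\<close>

lemma pfst_psnd_sum: "pfst p + psnd p = (LEAST y. Suc p - triangle (Suc y) = 0)"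
proof -
  obtain m n where p: "p = prod_encode (m, n)" by (metis pair_pfst_psnd)
  have mono: "triangle i \<le> triangle j" if "i \<le> j" for i j
    using that by (induction rule: dec_induct) simp_all
  have "(LEAST y. Suc p - triangle (Suc y) = 0) = m + n"
  proof (rule Least_equality)
    show "Suc p - triangle (Suc (m + n)) = 0" by (simp add: p prod_encode_def)
  next
    fix y assume y: "Suc p - triangle (Suc y) = 0"
    show "m + n \<le> y"
    proof (rule ccontr)
      assume "\<not> m + n \<le> y"
      then have "triangle (Suc y) \<le> triangle (m + n)" by (intro mono) simp
      also have "\<dots> < Suc p" by (simp add: p prod_encode_def)
      finally show False using y by linarith
    qed
  qed
  then show ?thesis by (simp only: p pfst_encode psnd_encode)
qed

text \<open>The diagonal of a pair is found by unbounded search, which ends because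
  \<open>triangle (Suc m)\<close> exceeds \<open>m\<close>. Truncated subtraction expresses
  \<open>p < triangle (Suc y)\<close> as an equation with 0.\<close>

lemma recn_sum: "recn 1 (\<lambda>xs. pfst (xs ! 0) + psnd (xs ! 0))"
proof -
  have "recn 1 (\<lambda>xs. LEAST y. (\<lambda>zs. Suc (zs ! 1) - triangle (Suc (zs ! 0))) (y # xs) = 0)"
  proof (rule recn_minimize)
    show "recn (Suc 1) (\<lambda>zs. Suc (zs ! 1) - triangle (Suc (zs ! 0)))"
      by (intro recn_comp2[OF recn_diff] recn_comp1[OF recn_triangle] recn_Suc recn_proj) auto
    have "Suc m - triangle (Suc m) = 0" for m by simp
    then show "\<exists>y. Suc ((y # xs) ! 1) - triangle (Suc ((y # xs) ! 0)) = 0" for xs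
      by (metis nth_Cons_0 One_nat_def nth_Cons_Suc)
  qed
  then show ?thesis by (simp add: pfst_psnd_sum)
qed

lemma recn_pfst: "recn 1 (\<lambda>xs. pfst (xs ! 0))"
proof -
  have "recn 1 (\<lambda>xs. xs ! 0 - triangle (pfst (xs ! 0) + psnd (xs ! 0)))"
    by (intro recn_comp2[OF recn_diff] recn_comp1[OF recn_triangle] recn_sum recn_proj) auto
  moreover have "p - triangle (pfst p + psnd p) = pfst p" for p
  proof -
    obtain m n where p: "p = prod_encode (m, n)" by (metis pair_pfst_psnd)
    show ?thesis by (simp only: p pfst_encode psnd_encode) (simp add: prod_encode_def)
  qed
  ultimately show ?thesis by simp
qed

lemma recn_psnd: "recn 1 (\<lambda>xs. psnd (xs ! 0))"
proof -
  have "recn 1 (\<lambda>xs. (pfst (xs ! 0) + psnd (xs ! 0)) - pfst (xs ! 0))"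
    by (intro recn_comp2[OF recn_diff] recn_pfst recn_sum)
  then show ?thesis by simp
qed

text \<open>Packing several arguments with \<open>prod_encode\<close> leaves a single arity. Closure
  rules then follow the syntax of a term with one free variable, and \<open>rec_intros\<close> can
  be applied mechanically.\<close>

definition rec :: "(nat \<Rightarrow> nat) \<Rightarrow> bool" where
  "rec f \<longleftrightarrow> recn 1 (\<lambda>xs. f (xs ! 0))"

lemma rec_comp: "rec f \<Longrightarrow> rec g \<Longrightarrow> rec (\<lambda>x. f (g x))"
  unfolding rec_def by (rule recn_comp1)

lemma rec_comp2: "recn 2 (\<lambda>ys. f (ys ! 0) (ys ! 1)) \<Longrightarrow> rec g \<Longrightarrow> rec h \<Longrightarrow> rec (\<lambda>x. f (g x) (h x))"
  unfolding rec_def by (rule recn_comp2[of f])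

named_theorems rec_intros

lemma rec_id [rec_intros]: "rec (\<lambda>x. x)"
  unfolding rec_def by (rule recn_proj) simp

lemma rec_const [rec_intros]: "rec (\<lambda>x. c)"
  unfolding rec_def by (rule recn_const)

lemma rec_Suc [rec_intros]: "rec f \<Longrightarrow> rec (\<lambda>x. Suc (f x))"
  unfolding rec_def by (rule recn_Suc)

lemma rec_add [rec_intros]: "rec f \<Longrightarrow> rec g \<Longrightarrow> rec (\<lambda>x. f x + g x)"
  by (rule rec_comp2[OF recn_add])

lemma rec_diff [rec_intros]: "rec f \<Longrightarrow> rec g \<Longrightarrow> rec (\<lambda>x. f x - g x)"
  by (rule rec_comp2[OF recn_diff])

lemma rec_pair [rec_intros]: "rec f \<Longrightarrow> rec g \<Longrightarrow> rec (\<lambda>x. prod_encode (f x, g x))"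
  by (rule rec_comp2[OF recn_prod_encode])

lemma rec_pfst [rec_intros]: "rec f \<Longrightarrow> rec (\<lambda>x. pfst (f x))"
  by (rule rec_comp[of pfst]) (simp_all only: rec_def recn_pfst)

lemma rec_psnd [rec_intros]: "rec f \<Longrightarrow> rec (\<lambda>x. psnd (f x))"
  by (rule rec_comp[of psnd]) (simp_all only: rec_def recn_psnd)

text \<open>The step function receives counter, previous value and parameter packed into one number,
  which keeps the rule within the unary calculus.\<close>

lemma rec_rec_nat [rec_intros]:
  assumes "rec f" "rec (\<lambda>p. g (pfst p) (pfst (psnd p)) (psnd (psnd p)))" "rec h"
  shows "rec (\<lambda>x. rec_nat (f x) (\<lambda>y r. g y r x) (h x))"
proof -
  let ?g = "\<lambda>zs::nat list. prod_encode (zs ! 0, prod_encode (zs ! 1, zs ! 2))"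
  have pr: "recn 2 (\<lambda>xs. rec_nat ((\<lambda>ys. f (ys ! 0)) (tl xs)) 
     (\<lambda>y r. (\<lambda>zs. g (pfst (?g zs)) (pfst (psnd (?g zs))) (psnd (psnd (?g zs)))) (y # r # tl xs)) (hd xs))"
    unfolding numeral_2_eq_2
  proof (rule recn_prim)
    show "recn (Suc 0) (\<lambda>ys. f (ys ! 0))" using assms(1) by (simp add: rec_def)
    show "recn (Suc (Suc (Suc 0))) (\<lambda>zs. g (pfst (prod_encode (zs ! 0, prod_encode (zs ! 1, zs ! Suc (Suc 0)))))
      (pfst (psnd (prod_encode (zs ! 0, prod_encode (zs ! 1, zs ! Suc (Suc 0))))))
      (psnd (psnd (prod_encode (zs ! 0, prod_encode (zs ! 1, zs ! Suc (Suc 0)))))))"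
      by (rule recn_comp1[of "\<lambda>p. g (pfst p) (pfst (psnd p)) (psnd (psnd p))"])
        (use assms(2) in \<open>auto simp: rec_def intro!: recn_comp2[OF recn_prod_encode] recn_proj\<close>)
  qed
  have "recn 2 (\<lambda>xs. rec_nat (f (xs ! 1)) (\<lambda>y r. g y r (xs ! 1)) (xs ! 0))"
    by (rule recn_cong[OF pr]) (auto simp: numeral_2_eq_2 length_Suc_conv)
  from rec_comp2[OF this assms(3) rec_id] show ?thesis .
qed

lemma rec_mult [rec_intros]:
  assumes "rec f" "rec g"
  shows "rec (\<lambda>x. f x * g x)"
proof -
  have "a * b = rec_nat 0 (\<lambda>y r. r + b) a" for a b :: nat
    by (induction a) simp_all
  moreover have "rec (\<lambda>x. rec_nat 0 (\<lambda>y r. r + g x) (f x))"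
    by (intro rec_intros assms rec_comp[OF assms(2)])
  ultimately show ?thesis by simp
qed

lemma rec_power [rec_intros]:
  assumes "rec f" "rec g"
  shows "rec (\<lambda>x. f x ^ g x)"
proof -
  have "a ^ n = rec_nat 1 (\<lambda>y r. r * a) n" for a n :: nat
    by (induction n) simp_all
  moreover have "rec (\<lambda>x. rec_nat 1 (\<lambda>y r. r * f x) (g x))"
    by (intro rec_intros assms rec_comp[OF assms(1)])
  ultimately show ?thesis by simp
qed

section \<open>Decidable predicates and bounded quantifiers\<close>

definition dec :: "(nat \<Rightarrow> bool) \<Rightarrow> bool" where
  "dec P \<longleftrightarrow> rec (\<lambda>x. if P x then 1 else 0)"

lemma decD: "dec P \<Longrightarrow> rec (\<lambda>x. if P x then 1 else 0)"
  by (simp add: dec_def)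

lemma dec_comp: "dec P \<Longrightarrow> rec f \<Longrightarrow> dec (\<lambda>x. P (f x))"
  unfolding dec_def by (rule rec_comp)

lemma rec_if [rec_intros]:
  assumes "dec P" "rec f" "rec g"
  shows "rec (\<lambda>x. if P x then f x else g x)"
proof -
  have eq: "(if P x then f x else g x) = 
    (if P x then 1 else 0) * f x + (1 - (if P x then 1 else 0)) * g x" for x by simp
  have "rec (\<lambda>x. (if P x then 1 else 0) * f x + (1 - (if P x then 1 else 0)) * g x)"
    by (intro rec_intros assms decD)
  then show ?thesis by (subst eq)
qed

lemma dec_le [rec_intros]:
  assumes "rec f" "rec g"
  shows "dec (\<lambda>x. f x \<le> g x)"
proof -
  have "(if f x \<le> g x then 1 else 0) = 1 - (f x - g x)" for x by simp
  moreover have "rec (\<lambda>x. 1 - (f x - g x))" by (intro rec_intros assms)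
  ultimately show ?thesis by (simp add: dec_def)
qed

lemma dec_not [rec_intros]: "dec P \<Longrightarrow> dec (\<lambda>x. \<not> P x)"
proof -
  assume "dec P"
  then have "rec (\<lambda>x. if P x then 0 else 1)" by (intro rec_intros)
  moreover have "(if P x then 0 else 1) = (if \<not> P x then 1 else 0::nat)" for x by simp
  ultimately show ?thesis by (simp only: dec_def)
qed

lemma dec_conj [rec_intros]: "dec P \<Longrightarrow> dec Q \<Longrightarrow> dec (\<lambda>x. P x \<and> Q x)"
proof -
  assume "dec P" "dec Q"
  then have "rec (\<lambda>x. if P x then if Q x then 1 else 0 else 0)" by (intro rec_intros)
  moreover have "(if P x then if Q x then 1 else 0 else 0) = (if P x \<and> Q x then 1 else 0::nat)" for x by simp
  ultimately show ?thesis by (simp only: dec_def)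
qed

lemma dec_imp [rec_intros]: "dec P \<Longrightarrow> dec Q \<Longrightarrow> dec (\<lambda>x. P x \<longrightarrow> Q x)"
  using dec_not[OF dec_conj[OF _ dec_not], of P Q] by (simp only: de_Morgan_conj not_not imp_conv_disj)

lemma dec_eq [rec_intros]: "rec f \<Longrightarrow> rec g \<Longrightarrow> dec (\<lambda>x. f x = g x)"
  using dec_conj[OF dec_le[of f g] dec_le[of g f]] by (simp only: order.eq_iff[symmetric])

lemma dec_True [rec_intros]: "dec (\<lambda>x. True)"
  by (simp add: dec_def rec_const)

lemma dec_all_le [rec_intros]:
  assumes "dec (\<lambda>p. P (pfst p) (psnd p))" "rec b"
  shows "dec (\<lambda>x. \<forall>y\<le>b x. P y x)"
proof -
  have *: "rec (\<lambda>x. rec_nat 1 (\<lambda>y r. if P y x then r else 0) (Suc (b x)))"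
    using dec_comp[OF assms(1), of "\<lambda>p. prod_encode (pfst p, psnd (psnd p))"]
    by (intro rec_intros assms(2)) (simp only: pfst_encode psnd_encode rec_intros)
  have "rec_nat 1 (\<lambda>y r. if P y x then r else 0) n = (if \<forall>y<n. P y x then 1 else 0)" for n x
    by (induction n) (auto simp: less_Suc_eq)
  from *[unfolded this less_Suc_eq_le] show ?thesis unfolding dec_def .
qed

lemma dec_ex_le [rec_intros]:
  assumes "dec (\<lambda>p. P (pfst p) (psnd p))" "rec b"
  shows "dec (\<lambda>x. \<exists>y\<le>b x. P y x)"
  using dec_not[OF dec_all_le[of "\<lambda>y x. \<not> P y x", OF dec_not[OF assms(1)] assms(2)]] by (simp only: not_all not_imp not_not)

lemma dec_finite_ball:
  assumes "finite A" "\<And>a. a \<in> A \<Longrightarrow> dec (P a)"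
  shows "dec (\<lambda>x. \<forall>a\<in>A. P a x)"
  using assms by (induction A rule: finite_induct) (auto intro!: rec_intros)

text \<open>A finite table is recursive however it was obtained. This is what admits letter
  translations that are picked by choice.\<close>

lemma rec_finite_support: "finite {n. f n \<noteq> 0} \<Longrightarrow> rec f"
proof (induction "{n. f n \<noteq> 0}" arbitrary: f rule: finite_induct)
  case empty
  then have "f = (\<lambda>x. 0)" by auto
  then show ?case by (simp add: rec_const)
next
  case (insert a A)
  have "rec (f(a := 0))"
    by (rule insert(3)) (use insert(2,4) in \<open>auto simp: set_eq_iff\<close>)
  then have "rec (\<lambda>x. if x = a then f a else (f(a := 0)) x)" by (intro rec_intros)
  moreover have "(\<lambda>x. if x = a then f a else (f(a := 0)) x) = f" by auto
  ultimately show ?case by simp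
qed

lemma dec_finite: "finite A \<Longrightarrow> dec (\<lambda>x. x \<in> A)"
  unfolding dec_def by (rule rec_finite_support) simp

lemma rec_half [rec_intros]:
  assumes "rec f"
  shows "rec (\<lambda>x. f x div 2)"
proof -
  \<comment> \<open>The recursion rests on \<open>Suc n div 2 = n - n div 2\<close>.\<close>
  have "n div 2 = rec_nat 0 (\<lambda>y r. y - r) n" for n :: nat
  proof (induction n)
    case (Suc n)
    then show ?case by simp
  qed simp
  moreover have "rec (\<lambda>x. rec_nat 0 (\<lambda>y r. y - r) (f x))" by (intro rec_intros assms)
  ultimately show ?thesis by simp
qed

lemma dec_set_decode [rec_intros]:
  assumes "rec f" "rec g"
  shows "dec (\<lambda>x. f x \<in> set_decode (g x))"
proof -
  have h: "rec_nat a (\<lambda>y r. r div 2) n = a div 2 ^ n" for a n :: nat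
    by (induction n) (simp_all add: div_mult2_eq[symmetric] mult.commute)
  let ?h = "\<lambda>x. rec_nat (g x) (\<lambda>y r. r div 2) (f x)"
  have "dec (\<lambda>x. \<not> ?h x = ?h x div 2 + ?h x div 2)" by (intro rec_intros assms)
  \<comment> \<open>Bit number \<open>f x\<close> is the parity after shifting that often, and a
    number is odd iff it differs from twice its half.\<close>
  moreover have "f x \<in> set_decode (g x) \<longleftrightarrow> \<not> ?h x = ?h x div 2 + ?h x div 2" for x
    unfolding set_decode_def h mem_Collect_eq by (metis even_two_times_div_two mult_2 dvd_triv_left)
  ultimately show ?thesis by simp
qed


section \<open>Recursion over codes of lists\<close>

definition lhd :: "nat \<Rightarrow> nat" where "lhd l = pfst (l - 1)"
definition ltl :: "nat \<Rightarrow> nat" where "ltl l = psnd (l - 1)"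

lemma lhd_encode [simp]: "lhd (list_encode (x # xs)) = x"
  and ltl_encode [simp]: "ltl (list_encode (x # xs)) = list_encode xs"
  by (simp_all add: lhd_def ltl_def)

lemma rec_lhd [rec_intros]: "rec f \<Longrightarrow> rec (\<lambda>x. lhd (f x))"
  unfolding lhd_def by (intro rec_intros)

lemma rec_ltl [rec_intros]: "rec f \<Longrightarrow> rec (\<lambda>x. ltl (f x))"
  unfolding ltl_def by (intro rec_intros)

lemma list_encode_eq_0 [simp]: "list_encode xs = 0 \<longleftrightarrow> xs = []"
  by (cases xs) auto

lemma ltl_le: "ltl l \<le> l"
  unfolding ltl_def by (metis le_prod_encode_2 pair_pfst_psnd diff_le_self le_trans)

lemma length_le_list_encode: "length xs \<le> list_encode xs"
proof (induction xs)
  case (Cons x xs)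
  then show ?case using le_prod_encode_2[of "list_encode xs" x] by simp
qed simp

lemma mem_le_list_encode: "x \<in> set xs \<Longrightarrow> x \<le> list_encode xs"
proof (induction xs)
  case (Cons y xs)
  then show ?case using le_prod_encode_2[of "list_encode xs" y] le_prod_encode_1[of y "list_encode xs"] by auto
qed simp

text \<open>The fold is iterated on pairs of accumulator and remaining list. The code of a list is
  at least its length, so \<open>l x\<close> rounds suffice, and surplus rounds are idle because the
  remaining list is empty.\<close>

lemma rec_foldl:
  assumes "rec a" "rec l" "rec (\<lambda>p. g (pfst p) (pfst (psnd p)) (psnd (psnd p)))"
  shows "rec (\<lambda>x. foldl (\<lambda>acc e. g acc e x) (a x) (list_decode (l x)))"
proof -
  let ?step = "\<lambda>x s. if psnd s = 0 then s else prod_encode (g (pfst s) (lhd (psnd s)) x, ltl (psnd s))"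
  have st: "rec_nat (prod_encode (b, list_encode ys)) (\<lambda>_. ?step x) n =
      prod_encode (foldl (\<lambda>acc e. g acc e x) b (take n ys), list_encode (drop n ys))" for b ys n x
  proof (induction n)
    case (Suc n)
    show ?case
    proof (cases "n < length ys")
      case True
      then have "drop n ys = ys ! n # drop (Suc n) ys" by (simp add: Cons_nth_drop_Suc)
      then show ?thesis using Suc True by (simp add: take_Suc_conv_app_nth del: list_encode.simps)
    next
      case False
      then show ?thesis using Suc by simp
    qed
  qed simp
  have eq: "foldl (\<lambda>acc e. g acc e x) (a x) (list_decode (l x)) =
    pfst (rec_nat (prod_encode (a x, l x)) (\<lambda>_. ?step x) (l x))" for x
    using st[of "a x" "list_decode (l x)" x "l x"] length_le_list_encode[of "list_decode (l x)"] by simp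
  have "rec (\<lambda>x. pfst (rec_nat (prod_encode (a x, l x)) (\<lambda>_. ?step x) (l x)))"
    using rec_comp[OF assms(3), of "\<lambda>p. prod_encode (pfst (pfst (psnd p)),
      prod_encode (lhd (psnd (pfst (psnd p))), psnd (psnd p)))"]
    by (intro rec_intros assms(1,2)) (simp only: pfst_encode psnd_encode rec_intros)
  then show ?thesis unfolding eq .
qed

definition recl :: "(nat \<Rightarrow> nat list) \<Rightarrow> bool" where
  "recl F \<longleftrightarrow> rec (\<lambda>x. list_encode (F x))"

lemma recl_decode [rec_intros]: "rec f \<Longrightarrow> recl (\<lambda>x. list_decode (f x))"
  by (simp add: recl_def)

lemma rec_list_encode [rec_intros]: "recl F \<Longrightarrow> rec (\<lambda>x. list_encode (F x))"
  by (simp add: recl_def)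

lemma recl_Cons [rec_intros]: "rec f \<Longrightarrow> recl F \<Longrightarrow> recl (\<lambda>x. f x # F x)"
  by (simp add: recl_def rec_intros)

lemma recl_const [rec_intros]: "recl (\<lambda>x. c)"
  by (simp add: recl_def rec_intros)

lemma recl_comp: "recl F \<Longrightarrow> rec g \<Longrightarrow> recl (\<lambda>x. F (g x))"
  unfolding recl_def by (rule rec_comp)

lemma recl_foldl:
  assumes "recl a" "recl l" "recl (\<lambda>p. g (list_decode (pfst p)) (pfst (psnd p)) (psnd (psnd p)))"
  shows "recl (\<lambda>x. foldl (\<lambda>acc e. g acc e x) (a x) (l x))"
proof -
  have "list_encode (foldl (\<lambda>acc e. g acc e x) b ys) =
     foldl (\<lambda>acc e. list_encode (g (list_decode acc) e x)) (list_encode b) ys" for b ys x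
    by (induction ys arbitrary: b) simp_all
  moreover have "rec (\<lambda>x. foldl (\<lambda>acc e. list_encode (g (list_decode acc) e x)) 
      (list_encode (a x)) (list_decode (list_encode (l x))))"
    using assms unfolding recl_def by (intro rec_foldl)
  ultimately show ?thesis by (simp add: recl_def)
qed

lemma recl_rev [rec_intros]:
  assumes "recl F"
  shows "recl (\<lambda>x. rev (F x))"
proof -
  have "rev xs = foldl (\<lambda>acc e. e # acc) [] xs" for xs :: "nat list"
    by (simp add: foldl_conv_fold fold_Cons_rev)
  then show ?thesis
    by (simp only:) (intro recl_foldl rec_intros assms)
qed

lemma recl_append [rec_intros]:
  assumes "recl F" "recl F'"
  shows "recl (\<lambda>x. F x @ F' x)"
proof -
  have "xs @ ys = foldl (\<lambda>acc e. e # acc) ys (rev xs)" for xs ys :: "nat list"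
    by (simp add: foldl_conv_fold fold_Cons_rev)
  then show ?thesis
    by (simp only:) (intro recl_foldl rec_intros assms)
qed

lemma recl_concat_map:
  assumes "recl F" "recl h"
  shows "recl (\<lambda>x. concat (map h (F x)))"
proof -
  have "foldl (\<lambda>acc e. acc @ h e) b xs = b @ concat (map h xs)" for b xs
    by (induction xs arbitrary: b) simp_all
  from this[of "[]"] have "concat (map h xs) = foldl (\<lambda>acc e. acc @ h e) [] xs" for xs by simp
  moreover have "recl (\<lambda>x. foldl (\<lambda>acc e. acc @ h e) [] (F x))"
    by (intro recl_foldl rec_intros recl_comp[OF assms(2)] assms)
  ultimately show ?thesis by simp
qed

lemma recl_concat_upt:
  assumes "recl (\<lambda>p. F (pfst p) (psnd p))" "rec b"
  shows "recl (\<lambda>x. concat (map (\<lambda>i. F i x) [0..<b x]))"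
proof -
  have h: "rec_nat 0 (\<lambda>i r. list_encode (list_decode r @ F i x)) n = 
      list_encode (concat (map (\<lambda>i. F i x) [0..<n]))" for x n
    by (induction n) simp_all
  have "rec (\<lambda>x. rec_nat 0 (\<lambda>i r. list_encode (list_decode r @ F i x)) (b x))"
    using recl_comp[OF assms(1), of "\<lambda>p. prod_encode (pfst p, psnd (psnd p))"]
    by (intro rec_intros assms) (simp only: pfst_encode psnd_encode rec_intros)
  then show ?thesis unfolding h recl_def .
qed

lemma recl_concat_replicate [rec_intros]:
  assumes "recl F" "rec b"
  shows "recl (\<lambda>x. concat (replicate (b x) (F x)))"
  using recl_concat_upt[of "\<lambda>i. F" b] assms
  by (simp add: map_replicate_trivial recl_comp[OF assms(1)] rec_intros)

definition lnth :: "nat \<Rightarrow> nat \<Rightarrow> nat" where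
  "lnth l i = lhd (rec_nat l (\<lambda>_ r. ltl r) i)"

lemma rec_lnth [rec_intros]: "rec f \<Longrightarrow> rec g \<Longrightarrow> rec (\<lambda>x. lnth (f x) (g x))"
  unfolding lnth_def by (intro rec_intros)

lemma lnth_eq: "lnth l i = (if i < length (list_decode l) then list_decode l ! i else 0)"
proof -
  \<comment> \<open>The code 0 of the empty list decodes to the pair (0, 0) under truncated
    subtraction. Reading past the end therefore stays at 0 and returns 0.\<close>
  have "lhd 0 = 0" "ltl 0 = 0"
    by (simp_all add: lhd_def ltl_def) (simp_all add: pfst_def psnd_def prod_decode_def prod_decode_aux.simps)
  moreover have "rec_nat l (\<lambda>_ r. ltl r) i = list_encode (drop i (list_decode l))"
  proof (induction i)
    case (Suc i)
    then show ?case using \<open>ltl 0 = 0\<close>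
      by (cases "drop i (list_decode l)") (auto simp: drop_Suc tl_drop[symmetric] simp del: list_encode.simps(2))
  qed simp
  ultimately show ?thesis unfolding lnth_def
    by (cases "drop i (list_decode l)") (auto simp del: list_encode.simps(2) simp: nth_via_drop)
qed

lemma dec_list_all:
  assumes "dec P" "recl F"
  shows "dec (\<lambda>x. \<forall>e\<in>set (F x). P e)"
proof -
  have h: "foldl (\<lambda>acc e. if P e then acc else 0) (b::nat) xs = (if \<forall>e\<in>set xs. P e then b else 0)" for b xs
    by (induction xs arbitrary: b) simp_all
  have "rec (\<lambda>x. foldl (\<lambda>acc e. if P e then acc else 0) 1 (list_decode (list_encode (F x))))"
    by (intro rec_foldl rec_intros assms dec_comp[OF assms(1)])
  then show ?thesis unfolding h dec_def by simp
qed

section \<open>Derivations in big-step form and a decision procedure for membership\<close>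

section \<open>Context-free grammars\<close>

text \<open>The word is split along the sentential form, so proofs can follow the form from left to
  right instead of dealing with rewriting at arbitrary positions.\<close>

inductive gens :: "('n, 't) productions \<Rightarrow> ('n, 't) symbol list \<Rightarrow> 't list \<Rightarrow> bool" for P where
  gens_Nil: "gens P [] []"
| gens_Terminal: "gens P \<beta> w \<Longrightarrow> gens P (Terminal a # \<beta>) (a # w)"
| gens_Nonterminal: "(A, \<alpha>) \<in> P \<Longrightarrow> gens P \<alpha> u \<Longrightarrow> gens P \<beta> v \<Longrightarrow> gens P (Nonterminal A # \<beta>) (u @ v)"

lemma gens_append: "gens P \<alpha> u \<Longrightarrow> gens P \<beta> v \<Longrightarrow> gens P (\<alpha> @ \<beta>) (u @ v)"
  by (induction rule: gens.induct) (auto intro: gens.intros)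

lemma gens_Nil_iff [simp]: "gens P [] w \<longleftrightarrow> w = []"
  by (auto intro: gens.intros elim: gens.cases)

lemma gens_Terminal_iff: "gens P (Terminal a # \<beta>) w \<longleftrightarrow> (\<exists>v. w = a # v \<and> gens P \<beta> v)"
  by (auto intro: gens.intros elim: gens.cases)

lemma gens_Nonterminal_iff: 
  "gens P (Nonterminal A # \<beta>) w \<longleftrightarrow> (\<exists>\<alpha> u v. (A, \<alpha>) \<in> P \<and> w = u @ v \<and> gens P \<alpha> u \<and> gens P \<beta> v)"
  by (rule iffI, erule gens.cases) (auto intro: gens.intros)

lemma gens_append_iff: 
  "gens P (\<alpha> @ \<beta>) w \<longleftrightarrow> (\<exists>u v. w = u @ v \<and> gens P \<alpha> u \<and> gens P \<beta> v)"
proof (induction \<alpha> arbitrary: w)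
  case (Cons s \<alpha>)
  show ?case
  proof (cases s)
    case (Nonterminal A)
    then show ?thesis by (simp add: gens_Nonterminal_iff Cons) (metis append.assoc)
  next
    case (Terminal a)
    then show ?thesis by (simp add: gens_Terminal_iff Cons) (metis append_Cons)
  qed
qed simp

lemma gens_map_Terminal: "gens P (map Terminal w) w"
  by (induction w) (auto intro: gens.intros)

lemma derives1_context: "derives1 P \<alpha> \<beta> \<Longrightarrow> derives1 P (u @ \<alpha> @ v) (u @ \<beta> @ v)"
proof (induction rule: derives1.induct)
  case (1 A \<alpha> u' v')
  then show ?case using derives1.intros[of A \<alpha> P "u @ u'" "v' @ v"] by simp
qed

lemma derives_context: "(derives1 P)\<^sup>*\<^sup>* \<alpha> \<beta> \<Longrightarrow> (derives1 P)\<^sup>*\<^sup>* (u @ \<alpha> @ v) (u @ \<beta> @ v)"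
  by (induction rule: rtranclp_induct) (auto intro: derives1_context rtranclp.intros)

lemma gens_iff_derives: "gens P \<alpha> w \<longleftrightarrow> (derives1 P)\<^sup>*\<^sup>* \<alpha> (map Terminal w)"
proof
  assume "gens P \<alpha> w"
  then show "(derives1 P)\<^sup>*\<^sup>* \<alpha> (map Terminal w)"
  proof (induction rule: gens.induct)
    case (gens_Terminal \<beta> w a)
    then show ?case using derives_context[of P \<beta> _ "[Terminal a]" "[]"] by simp
  next
    case (gens_Nonterminal A \<alpha> u \<beta> v)
    have "derives1 P (Nonterminal A # \<beta>) (\<alpha> @ \<beta>)"
      using derives1.intros[of A \<alpha> P "[]" \<beta>] gens_Nonterminal.hyps by simp
    also have "(derives1 P)\<^sup>*\<^sup>* (\<alpha> @ \<beta>) (map Terminal u @ \<beta>)"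
      using derives_context[of P \<alpha> _ "[]" \<beta>] gens_Nonterminal.IH by simp
    also have "(derives1 P)\<^sup>*\<^sup>* (map Terminal u @ \<beta>) (map Terminal u @ map Terminal v)"
      using derives_context[of P \<beta> _ "map Terminal u" "[]"] gens_Nonterminal.IH by simp
    finally show ?case by simp
  qed simp
next
  assume "(derives1 P)\<^sup>*\<^sup>* \<alpha> (map Terminal w)"
  then show "gens P \<alpha> w"
  proof (induction rule: converse_rtranclp_induct)
    case (step \<beta> \<gamma>)
    from step(1,3) show ?case
      by (induction rule: derives1.induct)
        (simp add: gens_append_iff gens_Nonterminal_iff, blast)
  qed (rule gens_map_Terminal)
qed

lemma language_of_gens: "language_of P S = {w. gens P [Nonterminal S] w}"
  by (simp add: language_of_def gens_iff_derives)

text \<open>Renaming acts on the leaves of derivation trees. Conversely a tree of the renamed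
  grammar lifts, since each production used in it is the image of some production of
  \<open>P\<close>, whose right-hand side supplies the original letters.\<close>

lemma language_of_map:
  fixes P :: "('n, 't) productions" and c :: "'t \<Rightarrow> 'u"
  shows "language_of (map_prod id (map (map_symbol id c)) ` P) S = map c ` language_of P S"
proof -
  define f :: "('n, 't) symbol \<Rightarrow> ('n, 'u) symbol" where "f = map_symbol id c"
  have f: "f (Nonterminal A) = Nonterminal A" "f (Terminal a) = Terminal (c a)" for A a
    by (simp_all add: f_def)
  have fN: "s = Nonterminal A" if "Nonterminal A = f s" for s A
    using that by (cases s) (simp_all add: f)
  have fT: "\<exists>b. s = Terminal b \<and> a = c b" if "Terminal a = f s" for s a
    using that by (cases s) (simp_all add: f)
  let ?P = "map_prod id (map f) ` P"
  have 1: "gens ?P (map f \<beta>) (map c w)" if "gens P \<beta> w" for \<beta> w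
    using that
  proof (induction rule: gens.induct)
    case (gens_Nonterminal A \<alpha> u \<beta> v)
    then have "(A, map f \<alpha>) \<in> ?P" by force
    then show ?case using gens_Nonterminal by (auto intro: gens.intros simp: f)
  qed (auto intro: gens.intros simp: f)
  have 2: "\<exists>w. w' = map c w \<and> gens P \<beta> w" if "gens ?P \<beta>' w'" "\<beta>' = map f \<beta>" for \<beta>' \<beta> w'
    using that
  proof (induction arbitrary: \<beta> rule: gens.induct)
    case (gens_Terminal \<gamma> w a)
    then obtain s \<delta> where "\<beta> = s # \<delta>" "Terminal a = f s" "\<gamma> = map f \<delta>"
      by (auto simp: Cons_eq_map_conv)
    with gens_Terminal.IH[of \<delta>] fT[of a s] show ?case by (metis gens.gens_Terminal list.map(2))
  next
    case (gens_Nonterminal A \<alpha> u \<gamma> v)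
    then obtain s \<delta> where \<delta>: "\<beta> = s # \<delta>" "Nonterminal A = f s" "\<gamma> = map f \<delta>"
      by (auto simp: Cons_eq_map_conv)
    from gens_Nonterminal(1) obtain \<alpha>' where "(A, \<alpha>') \<in> P" "\<alpha> = map f \<alpha>'" by auto
    with \<delta> gens_Nonterminal.IH(1)[of \<alpha>'] gens_Nonterminal.IH(2)[of \<delta>] fN[of A s] show ?case
      by (metis gens.gens_Nonterminal map_append)
  qed auto
  have "gens ?P [Nonterminal S] (map c w)" if "gens P [Nonterminal S] w" for w
    using 1[OF that] by (simp add: f)
  moreover have "\<exists>w. w' = map c w \<and> gens P [Nonterminal S] w" if "gens ?P [Nonterminal S] w'" for w'
    by (rule 2[OF that]) (simp add: f)
  ultimately show ?thesis
    unfolding language_of_gens f_def by blast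
qed

subsection \<open>Deciding membership\<close>

text \<open>With \<open>p\<close> and \<open>q\<close> codes of suffixes of the input, \<open>item p A q\<close> stands for the fact that \<open>A\<close>
  generates the part of \<open>p\<close> in front of \<open>q\<close>; \<open>W\<close> is the code of the whole input.\<close>

definition item :: "nat \<Rightarrow> nat \<Rightarrow> nat \<Rightarrow> nat" where
  "item p A q = prod_encode (p, prod_encode (A, q))"

lemma rec_item [rec_intros]: "rec f \<Longrightarrow> rec g \<Longrightarrow> rec h \<Longrightarrow> rec (\<lambda>x. item (f x) (g x) (h x))"
  unfolding item_def by (intro rec_intros)

lemma item_eq [simp]: "item p A q = item p' A' q' \<longleftrightarrow> p = p' \<and> A = A' \<and> q = q'"
  by (simp add: item_def)

text \<open>A dotted rule in the style of Earley: part of a right-hand side has been read from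
  \<open>p\<close> up to \<open>q\<close>, and \<beta> is still to come. However \<beta> is read off
  using the facts in the bit mask \<open>F\<close>, the resulting fact about \<open>A\<close> must
  be in \<open>F\<close>. The bound \<open>W\<close> on the quantifier keeps this decidable.\<close>

fun closed_rule :: "(nat, nat) symbol list \<Rightarrow> nat \<Rightarrow> nat \<Rightarrow> nat \<Rightarrow> nat \<Rightarrow> nat \<Rightarrow> bool" where
  "closed_rule [] q F A p W \<longleftrightarrow> item p A q \<in> set_decode F"
| "closed_rule (Terminal a # \<beta>) q F A p W \<longleftrightarrow>
    (q \<noteq> 0 \<and> lhd q = a \<longrightarrow> closed_rule \<beta> (ltl q) F A p W)"
| "closed_rule (Nonterminal B # \<beta>) q F A p W \<longleftrightarrow>
    (\<forall>q'\<le>W. item q B q' \<in> set_decode F \<longrightarrow> closed_rule \<beta> q' F A p W)"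

definition closed_facts :: "(nat, nat) productions \<Rightarrow> nat \<Rightarrow> nat \<Rightarrow> bool" where
  "closed_facts P F W \<longleftrightarrow> (\<forall>(A, \<alpha>)\<in>P. \<forall>p\<le>W. closed_rule \<alpha> p F A p W)"

lemma dec_closed_rule:
  "rec q \<Longrightarrow> rec F \<Longrightarrow> rec p \<Longrightarrow> rec W \<Longrightarrow> dec (\<lambda>x. closed_rule \<beta> (q x) (F x) A (p x) (W x))"
proof (induction \<beta> arbitrary: q F p W)
  case Nil
  then show ?case by (simp only: closed_rule.simps) (intro rec_intros)
next
  case (Cons s \<beta>)
  show ?case
  proof (cases s)
    case (Nonterminal B)
    have "dec (\<lambda>z. closed_rule \<beta> (pfst z) (F (psnd z)) A (p (psnd z)) (W (psnd z)))"
      by (intro Cons.IH rec_intros rec_comp[OF Cons.prems(2)] rec_comp[OF Cons.prems(3)] rec_comp[OF Cons.prems(4)])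
    then show ?thesis unfolding Nonterminal closed_rule.simps
      by (intro rec_intros Cons.prems rec_comp[OF Cons.prems(1)] rec_comp[OF Cons.prems(2)])
  next
    case (Terminal a)
    show ?thesis unfolding Terminal closed_rule.simps
      by (intro rec_intros Cons)
  qed
qed

lemma dec_closed_facts: 
  assumes "finite P" "rec F" "rec W"
  shows "dec (\<lambda>x. closed_facts P (F x) (W x))"
  unfolding closed_facts_def case_prod_beta
  by (intro dec_finite_ball assms dec_all_le dec_closed_rule rec_intros
      rec_comp[OF assms(2)] rec_comp[OF assms(3)])

text \<open>At a nonterminal, closure under the production used there, started at the current
  suffix, yields a fact in \<open>F\<close>; this fact instantiates the quantifier in
  \<open>closed_rule\<close>. Codes do not grow when passing to suffixes, so all of them stay below
  \<open>W\<close>.\<close>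

lemma closed_rule_gens:
  assumes P: "closed_facts P F W" and g: "gens P \<beta> w" 
    and "closed_rule \<beta> (list_encode (w @ v)) F A p W" "list_encode (w @ v) \<le> W"
  shows "item p A (list_encode v) \<in> set_decode F \<and> list_encode v \<le> W"
  using g assms(3,4)
proof (induction arbitrary: v A p rule: gens.induct)
  case gens_Nil
  then show ?case by simp
next
  case (gens_Terminal \<beta> w a)
  then show ?case using ltl_le[of "list_encode (a # w @ v)"] 
    by (simp del: list_encode.simps)
next
  case (gens_Nonterminal B \<alpha> u \<beta> w)
  have "closed_rule \<alpha> (list_encode (u @ w @ v)) F B (list_encode (u @ w @ v)) W"
    using P gens_Nonterminal unfolding closed_facts_def by fastforce
  then have "item (list_encode (u @ w @ v)) B (list_encode (w @ v)) \<in> set_decode F \<and> list_encode (w @ v) \<le> W"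
    using gens_Nonterminal by simp
  then have "closed_rule \<beta> (list_encode (w @ v)) F A p W" "list_encode (w @ v) \<le> W"
    using gens_Nonterminal.prems by simp_all
  then show ?case by (rule gens_Nonterminal.IH)
qed

lemma set_encode_le: "A \<subseteq> {..N} \<Longrightarrow> set_encode A \<le> 2 ^ Suc N"
proof -
  assume "A \<subseteq> {..N}"
  then have "set_encode A \<le> sum ((^) 2) {..N}"
    unfolding set_encode_def by (intro sum_mono2) auto
  also have "\<dots> \<le> 2 ^ Suc N"
    by (induction N) simp_all
  finally show ?thesis .
qed

lemma prod_encode_mono: "a \<le> a' \<Longrightarrow> b \<le> b' \<Longrightarrow> prod_encode (a, b) \<le> prod_encode (a', b')"
proof -
  assume *: "a \<le> a'" "b \<le> b'"
  have "triangle i \<le> triangle j" if "i \<le> j" for i j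
    using that by (induction rule: dec_induct) simp_all
  from this[of "a + b" "a' + b'"] * show ?thesis by (simp add: prod_encode_def)
qed

lemma item_mono: "p \<le> p' \<Longrightarrow> A \<le> A' \<Longrightarrow> q \<le> q' \<Longrightarrow> item p A q \<le> item p' A' q'"
  unfolding item_def by (intro prod_encode_mono)

text \<open>Every closed mask contains the derivable facts; conversely the set of true facts is
  itself closed. The bound on \<open>F\<close> is large enough to cover the mask of this set, whose
  members are at most \<open>item W m W\<close>.\<close>

lemma gens_iff_closed_facts:
  assumes "finite P" and bound: "\<And>A \<alpha>. (A, \<alpha>) \<in> P \<Longrightarrow> A \<le> m" and W_def: "W = list_encode w"
  shows "gens P [Nonterminal S] w \<longleftrightarrow> 
    (\<forall>F\<le>2 ^ Suc (item W m W). closed_facts P F W \<longrightarrow> item W S 0 \<in> set_decode F)"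
proof
  assume "gens P [Nonterminal S] w"
  then obtain \<alpha> where \<alpha>: "(S, \<alpha>) \<in> P" "gens P \<alpha> w" 
    by (auto simp: gens_Nonterminal_iff)
  then show "\<forall>F\<le>2 ^ Suc (item W m W). closed_facts P F W \<longrightarrow> item W S 0 \<in> set_decode F"
    using closed_rule_gens[of P _ W \<alpha> w "[]" S W] by (fastforce simp: closed_facts_def W_def)
next
  assume *: "\<forall>F\<le>2 ^ Suc (item W m W). closed_facts P F W \<longrightarrow> item W S 0 \<in> set_decode F"
  \<comment> \<open>The true facts, restricted to the ranges that \<open>closed_facts\<close>
    inspects so that the set is finite.\<close>
  define T where "T = {f. \<exists>p\<le>W. \<exists>q\<le>W. \<exists>A\<le>m. \<exists>u. f = item p A q \<and> gens P [Nonterminal A] u \<and> 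
    list_decode p = u @ list_decode q}"
  have T: "T \<subseteq> {..item W m W}" unfolding T_def by (auto intro: item_mono)
  have decode: "set_decode (set_encode T) = T"
    using finite_subset[OF T] by simp
  \<comment> \<open>Generalised to a dot inside the rule: \<open>u\<close> is what has been read so
    far, and any word generated by the rest \<beta> completes it to a word of
    \<open>A\<close>.\<close>
  have closed: "closed_rule \<beta> q (set_encode T) A p W"
    if "\<And>w v. gens P \<beta> v \<Longrightarrow> gens P [Nonterminal A] (u @ v)" "list_decode p = u @ list_decode q"
      "p \<le> W" "q \<le> W" "A \<le> m" for \<beta> q A p u
    using that
  proof (induction \<beta> arbitrary: q u)
    case Nil
    then show ?case unfolding closed_rule.simps decode by (auto simp: T_def)
  next
    case (Cons s \<beta>)
    show ?case
    proof (cases s)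
      case (Nonterminal B)
      show ?thesis unfolding Nonterminal closed_rule.simps decode
      proof (intro allI impI)
        fix q' assume q': "q' \<le> W" "item q B q' \<in> T"
        then obtain u' where u': "gens P [Nonterminal B] u'" "list_decode q = u' @ list_decode q'"
          by (auto simp: T_def)
        then have "gens P (Nonterminal B # \<beta>) (u' @ v)" if "gens P \<beta> v" for v
          using gens_append[OF u'(1) that] by simp
        then show "closed_rule \<beta> q' (set_encode T) A p W"
          using Cons.prems u' q' by (intro Cons.IH[of "u @ u'"]) (auto simp: Nonterminal)
      qed
    next
      case (Terminal a)
      show ?thesis unfolding Terminal closed_rule.simps
      proof
        assume q: "q \<noteq> 0 \<and> lhd q = a"
        then obtain xs where xs: "q = list_encode (a # xs)"
          by (metis lhd_encode list_decode_inverse list_encode.simps(1) list.exhaust)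
        show "closed_rule \<beta> (ltl q) (set_encode T) A p W"
          using Cons.prems xs ltl_le[of q] 
          by (intro Cons.IH[of "u @ [a]"]) (auto simp: Terminal gens_Terminal_iff simp del: list_encode.simps)
      qed
    qed
  qed
  have "closed_facts P (set_encode T) W"
    unfolding closed_facts_def
  proof (clarify)
    fix A \<alpha> p assume "(A, \<alpha>) \<in> P" "p \<le> W"
    then show "closed_rule \<alpha> p (set_encode T) A p W"
      by (intro closed[of _ _ "[]"]) (auto simp: gens_Nonterminal_iff dest: bound)
  qed
  then have "item W S 0 \<in> T"
    using * set_encode_le[OF T] decode by auto
  then show "gens P [Nonterminal S] w"
    by (auto simp: T_def W_def)
qed

theorem dec_context_free:
  fixes P :: "(nat, nat) productions"
  assumes "finite P" "recl w"
  shows "dec (\<lambda>x. w x \<in> language_of P S)"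
proof -
  obtain m where "\<forall>A\<in>fst ` P. A \<le> m"
    using finite_nat_set_iff_bounded_le[of "fst ` P"] assms by blast
  then have iff: "gens P [Nonterminal S] v \<longleftrightarrow> (\<forall>F\<le>2 ^ Suc (item (list_encode v) m (list_encode v)). 
      closed_facts P F (list_encode v) \<longrightarrow> item (list_encode v) S 0 \<in> set_decode F)" for v
    using assms(1) by (intro gens_iff_closed_facts) force+
  have w: "rec (\<lambda>x. list_encode (w x))" by (intro rec_intros assms)
  show ?thesis unfolding language_of_gens mem_Collect_eq iff
    by (intro rec_intros dec_closed_facts rec_comp[OF w] w assms)
qed

section \<open>Residuals in base two and linear systems with bounded carries\<close>

section \<open>Digitwise solution of linear systems\<close>

definition residual :: "(nat \<Rightarrow> nat) \<Rightarrow> (nat \<Rightarrow> nat) set \<Rightarrow> (nat \<Rightarrow> nat) set" where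
  "residual d Z = {x. (\<lambda>i. d i + 2 * x i) \<in> Z}"

lemma nat_mod_2_le: "a mod 2 \<le> (1::nat)"
  by presburger

text \<open>Each strict inclusion adds an element of \<open>F\<close>, so there are at most
  \<open>card F\<close> of them, and after the first equality the chain is constant.\<close>

lemma increasing_chain_stable:
  fixes U :: "nat \<Rightarrow> 'a set"
  assumes fin: "finite F" and sub: "\<And>n. U n \<subseteq> F" and mono: "\<And>n. U n \<subseteq> U (Suc n)"
    and stable: "\<And>n. U (Suc n) = U n \<Longrightarrow> U (Suc (Suc n)) = U (Suc n)"
  shows "U n \<subseteq> U (card F)"
proof -
  have "\<exists>N. (\<forall>n\<le>N. \<forall>m\<le>N. m < n \<longrightarrow> U m \<subset> U n) \<and> (\<forall>n\<ge>N. U N = U n)"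
    by (rule finite_mono_remains_stable_implies_strict_prefix)
      (use finite_subset[of "range U" "Pow F"] fin sub mono stable in \<open>auto simp: mono_iff_le_Suc\<close>)
  then obtain N where N: "\<And>m n. n \<le> N \<Longrightarrow> m < n \<Longrightarrow> U m \<subset> U n" "\<And>n. N \<le> n \<Longrightarrow> U N = U n"
    by (metis le_trans less_imp_le)
  have "m \<le> card (U m)" if "m \<le> N" for m
    using that
  proof (induction m)
    case (Suc m)
    have "card (U m) < card (U (Suc m))"
      using N(1)[of "Suc m" m] Suc.prems finite_subset[OF sub fin] by (intro psubset_card_mono) auto
    then show ?case using Suc by simp
  qed simp
  from this[of N] have "N \<le> card F" using card_mono[OF fin sub[of N]] by simp
  then have "U (card F) = U N" using N(2) by metis
  moreover have "U n \<subseteq> U N" 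
    using N(1)[of N n] N(2)[of n] by (cases "n < N") auto
  ultimately show ?thesis by simp
qed

text \<open>\<open>U j\<close> collects the members that miss a point with at most \<open>j\<close>
  binary digits per coordinate. Splitting off the lowest digits shows that \<open>U j\<close>
  determines \<open>U (Suc j)\<close>, so the increasing chain is constant from
  \<open>card \<F>\<close> on.\<close>

lemma residual_bound:
  assumes fin: "finite \<F>" and Z: "Z \<in> \<F>"
    and res: "\<And>Z d. Z \<in> \<F> \<Longrightarrow> \<forall>i. d i \<le> 1 \<Longrightarrow> residual d Z \<in> \<F>"
    and x: "x \<notin> Z" "\<forall>i. x i < 2 ^ j"
  shows "\<exists>y. y \<notin> Z \<and> (\<forall>i. y i < 2 ^ card \<F>)"
proof -
  define U where "U = (\<lambda>j. {Z\<in>\<F>. \<exists>x. x \<notin> Z \<and> (\<forall>i. x i < 2 ^ j)})"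
  have U_Suc: "U (Suc j) = {Z\<in>\<F>. \<exists>d. (\<forall>i. d i \<le> 1) \<and> residual d Z \<in> U j}" for j
  proof (intro equalityI subsetI)
    fix Z assume "Z \<in> U (Suc j)"
    then obtain x where x: "Z \<in> \<F>" "x \<notin> Z" "\<forall>i. x i < 2 ^ Suc j" by (auto simp: U_def)
    let ?d = "\<lambda>i. x i mod 2" and ?x = "\<lambda>i. x i div 2"
    have "?x \<notin> residual ?d Z" using x by (simp add: residual_def)
    moreover have "\<forall>i. ?x i < 2 ^ j" using x(3) by (simp add: less_mult_imp_div_less mult.commute)
    moreover have d: "\<forall>i. ?d i \<le> 1" by (simp only: nat_mod_2_le simp_thms)
    ultimately have "residual ?d Z \<in> U j" using res[OF x(1) d] unfolding U_def by blast
    then show "Z \<in> {Z\<in>\<F>. \<exists>d. (\<forall>i. d i \<le> 1) \<and> residual d Z \<in> U j}"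
      using x(1) d by (intro CollectI conjI exI[of _ ?d])
  next
    fix Z assume "Z \<in> {Z\<in>\<F>. \<exists>d. (\<forall>i. d i \<le> 1) \<and> residual d Z \<in> U j}"
    then obtain d x where "Z \<in> \<F>" "\<forall>i. d i \<le> 1" "x \<notin> residual d Z" "\<forall>i. x i < 2 ^ j"
      by (auto simp: U_def)
    moreover have "d i + 2 * x i < 2 ^ Suc j" if "d i \<le> 1" "x i < 2 ^ j" for i
      using that by simp
    ultimately show "Z \<in> U (Suc j)"
      unfolding U_def residual_def by (intro CollectI conjI exI[of _ "\<lambda>i. d i + 2 * x i"]) auto
  qed
  have "U j \<subseteq> U (card \<F>)"
  proof (rule increasing_chain_stable[OF fin])
    show "U n \<subseteq> \<F>" for n by (auto simp: U_def)
    show "U n \<subseteq> U (Suc n)" for n 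
    proof -
      have "a < 2 ^ Suc n" if "a < 2 ^ n" for a :: nat using that by simp
      then show ?thesis unfolding U_def by blast
    qed
    show "U (Suc (Suc n)) = U (Suc n)" if "U (Suc n) = U n" for n
      using U_Suc[of "Suc n", unfolded that] U_Suc[of n] by (simp only: that)
  qed
  then show ?thesis using Z x by (auto simp: U_def)
qed

lemma residual_Union: "residual d (\<Union>\<B>) = \<Union>(residual d ` \<B>)"
  by (auto simp: residual_def)

text \<open>Residuals of basic sets are only unions of basic sets. The family of all such unions is
  closed under residuals and has at most \<open>2 ^ card \<B>\<close> members, which adds one
  exponential.\<close>

lemma residual_Union_bound:
  assumes fin: "finite \<B>" and \<M>: "\<M> \<subseteq> \<B>"
    and res: "\<And>B d. B \<in> \<B> \<Longrightarrow> \<forall>i. d i \<le> 1 \<Longrightarrow> \<exists>\<C>\<subseteq>\<B>. residual d B = \<Union>\<C>"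
    and x: "x \<notin> \<Union>\<M>" "\<forall>i. x i < 2 ^ j"
  shows "\<exists>y. y \<notin> \<Union>\<M> \<and> (\<forall>i. y i < 2 ^ 2 ^ card \<B>)"
proof -
  let ?\<F> = "Union ` Pow \<B>"
  have "\<exists>y. y \<notin> \<Union>\<M> \<and> (\<forall>i. y i < 2 ^ card ?\<F>)"
  proof (rule residual_bound[OF _ _ _ x])
    fix Z and d :: "nat \<Rightarrow> nat" assume Z: "Z \<in> ?\<F>" and d: "\<forall>i. d i \<le> 1"
    then obtain \<D> where \<D>: "\<D> \<subseteq> \<B>" "Z = \<Union>\<D>" by auto
    have "\<forall>B\<in>\<D>. \<exists>\<C>\<subseteq>\<B>. residual d B = \<Union>\<C>" using res[OF _ d] \<D> by auto
    then obtain \<C> where "\<And>B. B \<in> \<D> \<Longrightarrow> \<C> B \<subseteq> \<B> \<and> residual d B = \<Union>(\<C> B)" by metis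
    then have "residual d Z = \<Union>(\<Union>(\<C> ` \<D>))" "\<Union>(\<C> ` \<D>) \<subseteq> \<B>"
      using \<D> by (auto simp: residual_Union)
    then show "residual d Z \<in> ?\<F>" by auto
  qed (use fin \<M> in auto)
  moreover have "(2::nat) ^ card ?\<F> \<le> 2 ^ 2 ^ card \<B>"
    using card_image_le[of "Pow \<B>" Union] fin by (simp add: card_Pow)
  ultimately show ?thesis by (meson less_le_trans)
qed

text \<open>The carries \<open>c\<close> arise when the system \<open>c + A m = x\<close> is solved digit by digit in base two,
  simultaneously for \<open>m\<close> and \<open>x\<close>. A row \<open>r\<close> has right-hand side \<open>x i\<close> if \<open>J r = Some i\<close> and
  \<open>0\<close> otherwise.\<close>

definition rhs_val :: "('r \<Rightarrow> nat option) \<Rightarrow> (nat \<Rightarrow> nat) \<Rightarrow> 'r \<Rightarrow> int" where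
  "rhs_val J x r = (case J r of None \<Rightarrow> 0 | Some i \<Rightarrow> int (x i))"

definition solset :: "'r set \<Rightarrow> ('r \<Rightarrow> nat option) \<Rightarrow> ('r \<Rightarrow> 'p \<Rightarrow> int) \<Rightarrow> 'p set \<Rightarrow> ('r \<Rightarrow> int) \<Rightarrow> (nat \<Rightarrow> nat) set" where
  "solset R J A T c = {x. \<exists>m::'p \<Rightarrow> nat. \<forall>r\<in>R. c r + (\<Sum>p\<in>T. A r p * int (m p)) = rhs_val J x r}"

definition carry :: "'r set \<Rightarrow> ('r \<Rightarrow> nat option) \<Rightarrow> ('r \<Rightarrow> 'p \<Rightarrow> int) \<Rightarrow> 'p set \<Rightarrow> int \<Rightarrow> (nat \<Rightarrow> nat) \<Rightarrow> ('r \<Rightarrow> int) \<Rightarrow> ('r \<Rightarrow> int) \<Rightarrow> bool" where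
  "carry R J A T K d c c' \<longleftrightarrow> c' \<in> PiE R (\<lambda>_. {- K..K}) \<and> 
    (\<exists>\<delta>::'p \<Rightarrow> nat. (\<forall>p. \<delta> p \<le> 1) \<and> (\<forall>r\<in>R. c r + (\<Sum>p\<in>T. A r p * int (\<delta> p)) = rhs_val J d r + 2 * c' r))"

text \<open>Write the solution as \<open>\<delta> + 2 * m\<close> with \<delta> its lowest digits.
  What the lowest digits leave over is twice the new carry \<open>c'\<close>. Its double is at most
  \<open>K\<close> from the old carry, plus \<open>K - 1\<close> from the coefficients, plus 1 from
  the digit of \<open>x\<close>; so \<open>c'\<close> is again at most \<open>K\<close> in absolute
  value.\<close>

lemma residual_solset:
  fixes A :: "'r \<Rightarrow> 'p \<Rightarrow> int" and K :: int
  assumes T: "finite T" and K: "\<And>r. r \<in> R \<Longrightarrow> (\<Sum>p\<in>T. \<bar>A r p\<bar>) + 1 \<le> K"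
    and c: "\<And>r. r \<in> R \<Longrightarrow> \<bar>c r\<bar> \<le> K" and d: "\<forall>i. d i \<le> 1"
  shows "residual d (solset R J A T c) = \<Union>{solset R J A T c' | c'. carry R J A T K d c c'}"
proof (intro equalityI subsetI)
  have rhs: "rhs_val J (\<lambda>i. d i + 2 * x i) r = rhs_val J d r + 2 * rhs_val J x r" for x r
    by (simp add: rhs_val_def split: option.splits)
  have sum: "(\<Sum>p\<in>T. A r p * int (\<delta> p + 2 * m p)) = (\<Sum>p\<in>T. A r p * int (\<delta> p)) + 2 * (\<Sum>p\<in>T. A r p * int (m p))" for r \<delta> m
    by (simp add: algebra_simps sum.distrib sum_distrib_left)
  {
    fix x assume "x \<in> residual d (solset R J A T c)"
    then obtain m :: "'p \<Rightarrow> nat" where m: "\<And>r. r \<in> R \<Longrightarrow> c r + (\<Sum>p\<in>T. A r p * int (m p)) = rhs_val J d r + 2 * rhs_val J x r"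
      by (auto simp: residual_def solset_def rhs)
    let ?\<delta> = "\<lambda>p. m p mod 2" and ?m = "\<lambda>p. m p div 2"
    \<comment> \<open>The carry is read off from the equation for the higher digits. The value
      \<open>undefined\<close> outside \<open>R\<close> makes it a member of the finite set
      \<open>PiE\<close>.\<close>
    define c' where "c' = (\<lambda>r. if r \<in> R then rhs_val J x r - (\<Sum>p\<in>T. A r p * int (?m p)) else undefined)"
    have c'_undef: "r \<notin> R \<Longrightarrow> c' r = undefined" for r by (simp add: c'_def)
    have eq: "c r + (\<Sum>p\<in>T. A r p * int (?\<delta> p)) = rhs_val J d r + 2 * c' r" if "r \<in> R" for r
      using m[OF that] sum[of r ?\<delta> ?m] that by (simp add: c'_def)
    have "- K \<le> c' r \<and> c' r \<le> K" if "r \<in> R" for r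
    proof -
      have "\<bar>\<Sum>p\<in>T. A r p * int (?\<delta> p)\<bar> \<le> (\<Sum>p\<in>T. \<bar>A r p\<bar>)"
        by (rule order.trans[OF sum_abs] sum_mono)+ (auto simp: abs_mult mod2_eq_if)
      moreover have "0 \<le> rhs_val J d r" "rhs_val J d r \<le> 1" 
        using d by (auto simp: rhs_val_def split: option.splits)
      ultimately show ?thesis using eq[OF that] K[OF that] c[OF that] by linarith
    qed
    then have "carry R J A T K d c c'" unfolding carry_def
      using eq by (intro conjI exI[of _ ?\<delta>] PiE_I) (auto simp: c'_undef nat_mod_2_le simp del: One_nat_def)
    moreover have "x \<in> solset R J A T c'"
      unfolding solset_def by (intro CollectI exI[of _ ?m]) (simp add: c'_def)
    ultimately show "x \<in> \<Union>{solset R J A T c' | c'. carry R J A T K d c c'}" by blast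
  next
    fix x assume "x \<in> \<Union>{solset R J A T c' | c'. carry R J A T K d c c'}"
    then obtain c' \<delta> m where 1: "\<And>r. r \<in> R \<Longrightarrow> c r + (\<Sum>p\<in>T. A r p * int (\<delta> p)) = rhs_val J d r + 2 * c' r"
      and 2: "\<And>r. r \<in> R \<Longrightarrow> c' r + (\<Sum>p\<in>T. A r p * int (m p)) = rhs_val J x r"
      unfolding solset_def carry_def by blast
    have "\<forall>r\<in>R. c r + (\<Sum>p\<in>T. A r p * int (\<delta> p + 2 * m p)) = rhs_val J d r + 2 * rhs_val J x r"
      unfolding sum using 1 2 by fastforce
    then show "x \<in> residual d (solset R J A T c)"
      unfolding residual_def solset_def mem_Collect_eq rhs by (rule exI[of _ "\<lambda>p. \<delta> p + 2 * m p"])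
  }
qed

lemma solset_cong: "(\<And>r. r \<in> R \<Longrightarrow> c r = c' r) \<Longrightarrow> solset R J A T c = solset R J A T c'"
  by (simp add: solset_def)

text \<open>Taking a residual keeps \<open>T\<close> and changes only the carry. The basic sets are
  therefore indexed by \<open>2 ^ card Pr\<close> choices of \<open>T\<close> and at most
  \<open>(2 * K + 1) ^ card R\<close> carry vectors.\<close>

lemma solset_Union_bound:
  fixes A :: "'r \<Rightarrow> 'p \<Rightarrow> int" and K :: nat
  assumes R: "finite R" and Pr: "finite Pr" 
    and K: "\<And>r. r \<in> R \<Longrightarrow> (\<Sum>p\<in>Pr. \<bar>A r p\<bar>) + 1 \<le> int K"
    and I: "\<And>T c. (T, c) \<in> I \<Longrightarrow> T \<subseteq> Pr \<and> (\<forall>r\<in>R. \<bar>c r\<bar> \<le> int K)"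
    and x: "x \<notin> (\<Union>(T, c)\<in>I. solset R J A T c)" "\<forall>i. x i < 2 ^ j"
  shows "\<exists>y. y \<notin> (\<Union>(T, c)\<in>I. solset R J A T c) \<and> 
    (\<forall>i. y i < 2 ^ 2 ^ (2 ^ card Pr * (2 * K + 1) ^ card R))"
proof -
  define C where "C = Pow Pr \<times> PiE R (\<lambda>_. {- int K..int K})"
  let ?sol = "\<lambda>(T, c). solset R J A T c"
  have fin: "finite C" unfolding C_def using R Pr by (auto intro: finite_PiE)
  have nat_eq: "nat (2 * int K + 1) = Suc (2 * K)" by simp
  have card: "card (?sol ` C) \<le> 2 ^ card Pr * (2 * K + 1) ^ card R"
    using card_image_le[OF fin, of ?sol] R Pr
    by (simp add: C_def card_cartesian_product card_Pow card_PiE nat_eq)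
  have "\<exists>y. y \<notin> \<Union>(?sol ` I) \<and> (\<forall>i. y i < 2 ^ 2 ^ card (?sol ` C))"
  proof (rule residual_Union_bound[OF _ _ _ x])
    show "finite (?sol ` C)" using fin by simp
    show "?sol ` I \<subseteq> ?sol ` C"
    proof (clarify)
      fix T c assume "(T, c) \<in> I"
      then have "(T, restrict c R) \<in> C" using I by (fastforce simp: C_def abs_le_iff)
      moreover have "solset R J A T c = ?sol (T, restrict c R)" by (simp, rule solset_cong) simp
      ultimately show "solset R J A T c \<in> ?sol ` C" by (rule rev_image_eqI)
    qed
    fix B and d :: "nat \<Rightarrow> nat" assume "B \<in> ?sol ` C" and d: "\<forall>i. d i \<le> 1"
    then obtain T c where T: "T \<subseteq> Pr" "c \<in> PiE R (\<lambda>_. {- int K..int K})" "B = solset R J A T c"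
      by (auto simp: C_def)
    have "(\<Sum>p\<in>T. \<bar>A r p\<bar>) + 1 \<le> int K" if "r \<in> R" for r
      using K[OF that] sum_mono2[OF Pr T(1), of "\<lambda>p. \<bar>A r p\<bar>"] by simp
    moreover have "\<bar>c r\<bar> \<le> int K" if "r \<in> R" for r
      using PiE_mem[OF T(2) that] by (auto simp: abs_le_iff)
    ultimately have "residual d B = \<Union>{solset R J A T c' | c'. carry R J A T (int K) d c c'}"
      unfolding T(3) by (rule residual_solset[OF finite_subset[OF T(1) Pr] _ _ d])
    moreover have "{solset R J A T c' | c'. carry R J A T (int K) d c c'} \<subseteq> ?sol ` C"
    proof (clarify)
      fix c' assume "carry R J A T (int K) d c c'"
      then have "(T, c') \<in> C" using T(1) by (auto simp: C_def carry_def)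
      then show "solset R J A T c' \<in> ?sol ` C" by (rule rev_image_eqI) simp
    qed
    ultimately show "\<exists>\<C>\<subseteq>?sol ` C. residual d B = \<Union>\<C>" by blast
  qed
  moreover have "(2::nat) ^ 2 ^ card (?sol ` C) \<le> 2 ^ 2 ^ (2 ^ card Pr * (2 * K + 1) ^ card R)"
    using card by simp
  ultimately show ?thesis by (meson less_le_trans)
qed

section \<open>Commutative grammars: Euler-type criterion and reduction to linear systems\<close>

section \<open>Commutative grammars\<close>

datatype 'v crule = CRule (lhs: 'v) (rhs: "'v multiset") (wt: "nat \<Rightarrow> nat")

inductive commutes :: "'v crule set \<Rightarrow> 'v multiset \<Rightarrow> (nat \<Rightarrow> nat) \<Rightarrow> bool" for R where
  commutes_empty: "commutes R {#} (\<lambda>i. 0)"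
| commutes_step: "p \<in> R \<Longrightarrow> commutes R (rhs p + \<alpha>) x \<Longrightarrow> commutes R (add_mset (lhs p) \<alpha>) (\<lambda>i. wt p i + x i)"

definition edges :: "'v crule set \<Rightarrow> ('v \<times> 'v) set" where
  "edges T = {(u, v). \<exists>p\<in>T. lhs p = u \<and> v \<in># rhs p}"

definition reach :: "'v crule set \<Rightarrow> 'v multiset \<Rightarrow> 'v set" where
  "reach T \<alpha> = (edges T)\<^sup>* `` set_mset \<alpha>"

text \<open>The flow condition of an Euler argument: each symbol present at the start or produced
  later is consumed by exactly one rule application, so that nothing is left.\<close>

definition balanced :: "'v crule set \<Rightarrow> ('v crule \<Rightarrow> nat) \<Rightarrow> 'v multiset \<Rightarrow> bool" where
  "balanced R n \<alpha> \<longleftrightarrow> (\<forall>v. count \<alpha> v + (\<Sum>p\<in>R. n p * count (rhs p) v) = (\<Sum>p\<in>R. n p * of_bool (lhs p = v)))"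

definition used :: "'v crule set \<Rightarrow> ('v crule \<Rightarrow> nat) \<Rightarrow> 'v crule set" where
  "used R n = {p\<in>R. 0 < n p}"

lemma reach_base: "v \<in># \<alpha> \<Longrightarrow> v \<in> reach T \<alpha>"
  by (auto simp: reach_def)

lemma reach_step: "lhs p \<in> reach T \<alpha> \<Longrightarrow> p \<in> T \<Longrightarrow> v \<in># rhs p \<Longrightarrow> v \<in> reach T \<alpha>"
  unfolding reach_def edges_def by (auto simp: Image_iff intro: rtrancl_into_rtrancl)

lemma reach_subset:
  assumes "set_mset \<alpha> \<subseteq> C" "\<And>p v. p \<in> T \<Longrightarrow> lhs p \<in> C \<Longrightarrow> v \<in># rhs p \<Longrightarrow> v \<in> C"
  shows "reach T \<alpha> \<subseteq> C"
proof
  fix v assume "v \<in> reach T \<alpha>"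
  then obtain a where "a \<in># \<alpha>" "(a, v) \<in> (edges T)\<^sup>*" by (auto simp: reach_def)
  from this(2,1) show "v \<in> C"
    by (induction rule: rtrancl_induct) (use assms in \<open>auto simp: edges_def\<close>)
qed

text \<open>The factor \<open>f\<close> is arbitrary so that one fact covers produced symbols,
  consumed symbols, weights and the number of applications.\<close>

lemma sum_dec:
  fixes n :: "'p \<Rightarrow> nat"
  assumes "finite R" "p \<in> R" "0 < n p"
  shows "(\<Sum>q\<in>R. n q * f q) = f p + (\<Sum>q\<in>R. (n(p := n p - 1)) q * f q)"
proof -
  have "(\<Sum>q\<in>R. n q * f q) = n p * f p + (\<Sum>q\<in>R - {p}. n q * f q)"
    by (rule sum.remove) (use assms in auto)
  moreover have "(\<Sum>q\<in>R. (n(p := n p - 1)) q * f q) = (n p - 1) * f p + (\<Sum>q\<in>R - {p}. n q * f q)"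
    by (subst sum.remove[of _ p]) (use assms in auto)
  moreover have "n p * f p = f p + (n p - 1) * f p" using assms(3) by (cases "n p") auto
  ultimately show ?thesis by simp
qed

lemma commutes_counts:
  assumes R: "finite R" and "commutes R \<alpha> x"
  shows "\<exists>n. balanced R n \<alpha> \<and> lhs ` used R n \<subseteq> reach (used R n) \<alpha> \<and> x = (\<lambda>i. \<Sum>p\<in>R. n p * wt p i)"
  using assms(2)
proof (induction rule: commutes.induct)
  case commutes_empty
  then show ?case by (intro exI[of _ "\<lambda>_. 0"]) (auto simp: balanced_def used_def)
next
  case (commutes_step p \<alpha> x)
  then obtain n where n: "balanced R n (rhs p + \<alpha>)" "lhs ` used R n \<subseteq> reach (used R n) (rhs p + \<alpha>)"
    "x = (\<lambda>i. \<Sum>p\<in>R. n p * wt p i)" by blast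
  let ?n = "n(p := Suc (n p))"
  have "n = ?n(p := ?n p - 1)" by auto
  with sum_dec[OF R commutes_step(1), of ?n] 
  have sum: "(\<Sum>q\<in>R. ?n q * f q) = f p + (\<Sum>q\<in>R. n q * f q)" for f by simp
  have "count (add_mset (lhs p) \<alpha>) u + (\<Sum>q\<in>R. ?n q * count (rhs q) u) = (\<Sum>q\<in>R. ?n q * of_bool (lhs q = u))" for u
    using n(1) unfolding balanced_def sum by (auto dest!: spec[of _ u])
  then have "balanced R ?n (add_mset (lhs p) \<alpha>)" unfolding balanced_def by blast
  moreover have used: "used R ?n = insert p (used R n)" using commutes_step(1) by (auto simp: used_def)
  have "reach (used R n) (rhs p + \<alpha>) \<subseteq> reach (used R ?n) (add_mset (lhs p) \<alpha>)"
  proof (rule reach_subset)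
    have "u \<in> reach (used R ?n) (add_mset (lhs p) \<alpha>)" if "u \<in># rhs p" for u
      by (rule reach_step[of p]) (use that used in \<open>auto intro: reach_base\<close>)
    then show "set_mset (rhs p + \<alpha>) \<subseteq> reach (used R ?n) (add_mset (lhs p) \<alpha>)"
      by (auto intro: reach_base)
  next
    fix q u assume "q \<in> used R n" "lhs q \<in> reach (used R ?n) (add_mset (lhs p) \<alpha>)" "u \<in># rhs q"
    then show "u \<in> reach (used R (n(p := Suc (n p)))) (add_mset (lhs p) \<alpha>)"
      using reach_step[of q] used by blast
  qed
  then have "lhs ` used R ?n \<subseteq> reach (used R ?n) (add_mset (lhs p) \<alpha>)"
    using n(2) unfolding used by (auto intro: reach_base)
  moreover have "(\<lambda>i. wt p i + x i) = (\<lambda>i. \<Sum>p\<in>R. ?n p * wt p i)"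
    unfolding sum n(3) ..
  ultimately show ?case by blast
qed

text \<open>Applying \<open>p\<close> removes one copy of \<open>lhs p\<close> and puts the targets
  of its edges into the multiset. If \<open>lhs p\<close> can still be reached, every old path
  survives from one of these places on.\<close>

lemma reach_after_step:
  assumes p: "p \<in> used R n" "lhs p \<in># \<alpha>" and Y: "lhs p \<in> reach (used R (n(p := n p - 1))) (\<alpha> - {#lhs p#} + rhs p)"
  shows "reach (used R n) \<alpha> \<subseteq> reach (used R (n(p := n p - 1))) (\<alpha> - {#lhs p#} + rhs p)"
proof (rule reach_subset)
  show "set_mset \<alpha> \<subseteq> reach (used R (n(p := n p - 1))) (\<alpha> - {#lhs p#} + rhs p)"
  proof
    fix a assume "a \<in># \<alpha>"
    then show "a \<in> reach (used R (n(p := n p - 1))) (\<alpha> - {#lhs p#} + rhs p)"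
      using Y by (cases "a = lhs p") (auto intro!: reach_base simp: in_diff_count)
  qed
next
  fix q v assume q: "q \<in> used R n" "lhs q \<in> reach (used R (n(p := n p - 1))) (\<alpha> - {#lhs p#} + rhs p)" "v \<in># rhs q"
  show "v \<in> reach (used R (n(p := n p - 1))) (\<alpha> - {#lhs p#} + rhs p)"
  proof (cases "q = p")
    case True
    then show ?thesis using q by (auto intro: reach_base)
  next
    case False
    then have "q \<in> used R (n(p := n p - 1))" using q(1) by (simp add: used_def)
    then show ?thesis by (rule reach_step[OF q(2) _ q(3)])
  qed
qed

text \<open>Cut the path at its first visit to \<open>Y\<close>. It then runs without any rule for
  \<open>Y\<close>, hence survives when an application of such a rule is spent.\<close>

lemma rtrancl_avoiding_source:
  assumes "(Z, Y) \<in> (edges T)\<^sup>*"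
  shows "(Z, Y) \<in> (edges {q\<in>T. lhs q \<noteq> Y})\<^sup>*"
  using assms
proof (induction rule: converse_rtrancl_induct)
  case (step Z W)
  show ?case
  proof (cases "Z = Y")
    case False
    then have "(Z, W) \<in> edges {q\<in>T. lhs q \<noteq> Y}" using step(1) by (auto simp: edges_def)
    then show ?thesis using step by (auto intro: converse_rtrancl_into_rtrancl)
  qed simp
qed simp

text \<open>If some \<open>Y \<in># \<alpha>\<close> lies on a cycle, the first rule of the cycle will do, since \<open>Y\<close> is recovered.
  Otherwise any rule for any \<open>Y \<in># \<alpha>\<close> will do: if \<open>Y\<close> were lost but still needed, balance would force
  a remaining rule to produce \<open>Y\<close>, and such a rule, being reachable only through \<open>Y\<close>, would close
  a cycle.\<close>

lemma euler_step:
  assumes R: "finite R" and bal: "balanced R n \<alpha>" and con: "lhs ` used R n \<subseteq> reach (used R n) \<alpha>"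
    and ne: "\<alpha> \<noteq> {#}"
  shows "\<exists>p\<in>used R n. lhs p \<in># \<alpha> \<and> balanced R (n(p := n p - 1)) (\<alpha> - {#lhs p#} + rhs p) \<and>
    lhs ` used R (n(p := n p - 1)) \<subseteq> reach (used R (n(p := n p - 1))) (\<alpha> - {#lhs p#} + rhs p)"
proof -
  have bal': "balanced R (n(p := n p - 1)) (\<alpha> - {#lhs p#} + rhs p)" if "p \<in> used R n" "lhs p \<in># \<alpha>" for p
    unfolding balanced_def
  proof
    fix v
    have p: "p \<in> R" "0 < n p" using that by (auto simp: used_def)
    have "count \<alpha> v + (\<Sum>p\<in>R. n p * count (rhs p) v) = (\<Sum>p\<in>R. n p * of_bool (lhs p = v))"
      using bal by (simp add: balanced_def)
    then show "count (\<alpha> - {#lhs p#} + rhs p) v + (\<Sum>q\<in>R. (n(p := n p - 1)) q * count (rhs q) v) =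
       (\<Sum>q\<in>R. (n(p := n p - 1)) q * of_bool (lhs q = v))"
      unfolding sum_dec[of R p n, OF R p] using that(2) by (cases "lhs p = v") (auto simp: count_greater_zero_iff[symmetric] simp del: count_greater_zero_iff)
  qed
  have rule_for: "\<exists>p\<in>used R n. lhs p = Y" if "Y \<in># \<alpha>" for Y
  proof (rule ccontr)
    assume "\<not> ?thesis"
    then have "(\<Sum>p\<in>R. n p * of_bool (lhs p = Y)) = 0" by (intro sum.neutral ballI) (auto simp: used_def)
    moreover have "count \<alpha> Y + (\<Sum>p\<in>R. n p * count (rhs p) Y) = (\<Sum>p\<in>R. n p * of_bool (lhs p = Y))"
      using bal by (simp add: balanced_def)
    ultimately show False using that by (simp add: count_greater_zero_iff[symmetric] del: count_greater_zero_iff)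
  qed
  have used_dec: "used R (n(p := n p - 1)) \<subseteq> used R n" for p by (auto simp: used_def split: if_splits)
  show ?thesis
  proof (cases "\<exists>Y\<in>#\<alpha>. (Y, Y) \<in> (edges (used R n))\<^sup>+")
    case True
    then obtain Y Z where Y: "Y \<in># \<alpha>" "(Y, Z) \<in> edges (used R n)" "(Z, Y) \<in> (edges (used R n))\<^sup>*"
      by (auto dest: tranclD)
    from Y(2) obtain p where p: "p \<in> used R n" "lhs p = Y" "Z \<in># rhs p" by (auto simp: edges_def)
    let ?n = "n(p := n p - 1)" and ?\<alpha> = "\<alpha> - {#lhs p#} + rhs p"
    have "edges {q\<in>used R n. lhs q \<noteq> Y} \<subseteq> edges (used R ?n)"
      using p by (auto simp: edges_def used_def)
    then have "(Z, Y) \<in> (edges (used R ?n))\<^sup>*"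
      using rtrancl_avoiding_source[OF Y(3)] rtrancl_mono by blast
    then have "lhs p \<in> reach (used R ?n) ?\<alpha>" using p by (auto simp: reach_def)
    then have "reach (used R n) \<alpha> \<subseteq> reach (used R ?n) ?\<alpha>"
      using p Y by (intro reach_after_step) auto
    then have "lhs ` used R ?n \<subseteq> reach (used R ?n) ?\<alpha>" using con used_dec by blast
    then show ?thesis using bal'[of p] p Y by blast
  next
    case False
    obtain Y where Y: "Y \<in># \<alpha>" using ne by blast
    obtain p where p: "p \<in> used R n" "lhs p = Y" using rule_for[OF Y] by blast
    let ?n = "n(p := n p - 1)" and ?\<alpha> = "\<alpha> - {#lhs p#} + rhs p"
    let ?reach = "reach (used R ?n) ?\<alpha>"
    have "lhs ` used R ?n \<subseteq> ?reach"
    proof (cases "Y \<in> ?reach")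
      case True
      then have "reach (used R n) \<alpha> \<subseteq> ?reach"
        using p Y by (intro reach_after_step) auto
      then show ?thesis using con used_dec by blast
    next
      case lost: False
      have edge: "v \<in> ?reach" if "q \<in> used R n" "v \<in># rhs q" "lhs q \<in> ?reach" for q v
      proof -
        have "q \<noteq> p" using that lost p by auto
        then show ?thesis using reach_step[OF that(3) _ that(2)] that by (simp add: used_def)
      qed
      have base: "a \<in> ?reach" if "a \<in># \<alpha>" "a \<noteq> Y" for a
        using that p by (auto intro!: reach_base simp: in_diff_count)
      have Y_dead: "(\<Sum>q\<in>R. ?n q * of_bool (lhs q = Y)) = 0"
      proof (rule ccontr)
        assume "(\<Sum>q\<in>R. ?n q * of_bool (lhs q = Y)) \<noteq> 0"
        moreover have "count ?\<alpha> Y = 0" using lost reach_base[of Y ?\<alpha>] by (metis count_inI)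
        moreover have "count ?\<alpha> Y + (\<Sum>q\<in>R. ?n q * count (rhs q) Y) = (\<Sum>q\<in>R. ?n q * of_bool (lhs q = Y))"
          using bal'[OF p(1)] Y p(2) unfolding balanced_def by blast
        ultimately have "(\<Sum>q\<in>R. ?n q * count (rhs q) Y) \<noteq> 0" by linarith
        then obtain q where "q \<in> R" "?n q * count (rhs q) Y \<noteq> 0"
          by (rule sum.not_neutral_contains_not_neutral)
        then have q: "q \<in> R" "?n q \<noteq> 0" "Y \<in># rhs q"
          by (auto simp only: mult_eq_0_iff intro: count_inI)
        then have q': "q \<in> used R ?n" by (simp add: used_def)
        then have "lhs q \<notin> ?reach" using lost q(3) reach_step by metis
        moreover have "reach (used R n) \<alpha> \<subseteq> ?reach \<union> {v. (Y, v) \<in> (edges (used R n))\<^sup>*}"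
          using base by (intro reach_subset) (auto dest: edge intro: rtrancl_into_rtrancl simp: edges_def)
        ultimately have "(Y, lhs q) \<in> (edges (used R n))\<^sup>*" using con q' used_dec by blast
        moreover have "(lhs q, Y) \<in> edges (used R n)" using q(3) q' used_dec[of p] unfolding edges_def by blast
        ultimately show False using False Y by (meson rtrancl_into_trancl1)
      qed
      have dead: "?n q * of_bool (lhs q = Y) = 0" if "q \<in> R" for q
        using Y_dead R that by (simp only: sum_eq_0_iff)
      have only_p: "q = p" if "q \<in> used R n" "lhs q = Y" for q
      proof (rule ccontr)
        assume "q \<noteq> p"
        then have f: "?n q * of_bool (lhs q = Y) \<noteq> 0" "q \<in> R" using that by (auto simp: used_def)
        from f(1) dead[OF f(2)] show False by (rule notE)
      qed
      \<comment> \<open>The only used rule for \<open>Y\<close> is \<open>p\<close>, and its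
        products already lie in the new multiset. So no vertex other than \<open>Y\<close> can be
        lost.\<close>
      have "reach (used R n) \<alpha> \<subseteq> insert Y ?reach"
      proof (rule reach_subset)
        show "set_mset \<alpha> \<subseteq> insert Y ?reach" using base by blast
        fix q v assume q: "q \<in> used R n" "lhs q \<in> insert Y ?reach" "v \<in># rhs q"
        show "v \<in> insert Y ?reach"
        proof (cases "lhs q = Y")
          case True
          then have "v \<in># ?\<alpha>" using only_p q by simp
          then show ?thesis by (simp add: reach_base)
        next
          case False
          then show ?thesis using edge q by blast
        qed
      qed
      moreover have "lhs q \<noteq> Y" if "q \<in> used R ?n" for q
      proof
        assume "lhs q = Y"
        then have f: "?n q * of_bool (lhs q = Y) \<noteq> 0" "q \<in> R" using that by (auto simp: used_def)
        from f(1) dead[OF f(2)] show False by (rule notE)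
      qed
      ultimately show ?thesis using con used_dec by blast
    qed
    then show ?thesis using bal'[of p] p Y by blast
  qed
qed

text \<open>Induction on the total number of applications: \<open>euler_step\<close> picks a rule
  that may be applied now without destroying balance or reachability of the rest.\<close>

lemma counts_commutes:
  assumes R: "finite R" 
    and "balanced R n \<alpha>" "lhs ` used R n \<subseteq> reach (used R n) \<alpha>"
  shows "commutes R \<alpha> (\<lambda>i. \<Sum>p\<in>R. n p * wt p i)"
  using assms(2,3)
proof (induction "\<Sum>p\<in>R. n p" arbitrary: n \<alpha> rule: less_induct)
  case less
  show ?case
  proof (cases "\<alpha> = {#}")
    case True
    \<comment> \<open>Nothing is reachable from the empty multiset; this rules out balanced cycles
      detached from \<alpha>.\<close>
    then have "used R n = {}" using less.prems(2) by (auto simp: reach_def)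
    then have "(\<Sum>p\<in>R. n p * wt p i) = 0" for i by (auto simp: used_def)
    then show ?thesis using True commutes_empty by simp
  next
    case False
    from euler_step[OF R less.prems False] obtain p where p: "p \<in> used R n" "lhs p \<in># \<alpha>"
      and *: "balanced R (n(p := n p - 1)) (\<alpha> - {#lhs p#} + rhs p)"
        "lhs ` used R (n(p := n p - 1)) \<subseteq> reach (used R (n(p := n p - 1))) (\<alpha> - {#lhs p#} + rhs p)"
      by blast
    from p have pR: "p \<in> R" "0 < n p" by (auto simp: used_def)
    have "(\<Sum>q\<in>R. (n(p := n p - 1)) q) < (\<Sum>q\<in>R. n q)"
      using sum_dec[of R p n "\<lambda>_. 1", OF R pR] by simp
    from less.hyps[OF this *] have "commutes R (rhs p + (\<alpha> - {#lhs p#})) (\<lambda>i. \<Sum>q\<in>R. (n(p := n p - 1)) q * wt q i)"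
      by (simp add: add.commute)
    with pR(1) have "commutes R (add_mset (lhs p) (\<alpha> - {#lhs p#})) (\<lambda>i. wt p i + (\<Sum>q\<in>R. (n(p := n p - 1)) q * wt q i))"
      by (rule commutes_step)
    then show ?thesis unfolding sum_dec[of R p n, OF R pR] using p(2) by simp
  qed
qed

lemma commutes_iff:
  assumes "finite R"
  shows "commutes R \<alpha> x \<longleftrightarrow> (\<exists>n. balanced R n \<alpha> \<and> lhs ` used R n \<subseteq> reach (used R n) \<alpha> \<and> x = (\<lambda>i. \<Sum>p\<in>R. n p * wt p i))"
  using commutes_counts[OF assms] counts_commutes[OF assms] by blast

lemma count_le_size: "count \<alpha> v \<le> size \<alpha>"
  by (induction \<alpha>) auto

text \<open>The system has a row with right-hand side 0 for each symbol, stating balance, and a row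
  with right-hand side \<open>x i\<close> for each weight coordinate. In \<open>K\<close>, the
  product bounds a row sum of absolute coefficients, \<rho> bounds the entries contributed by
  \<alpha>, and 1 leaves room for a digit.\<close>

theorem commutes_bound:
  fixes R :: "'v crule set"
  assumes fin: "finite R" "finite V"
    and V: "\<And>p. p \<in> R \<Longrightarrow> lhs p \<in> V" "\<And>p. p \<in> R \<Longrightarrow> set_mset (rhs p) \<subseteq> V" "set_mset \<alpha> \<subseteq> V"
    and size: "\<And>p. p \<in> R \<Longrightarrow> size (rhs p) \<le> \<rho>" "size \<alpha> \<le> \<rho>"
    and wt: "\<And>p i. p \<in> R \<Longrightarrow> wt p i \<le> 1" "\<And>p i. p \<in> R \<Longrightarrow> k \<le> i \<Longrightarrow> wt p i = 0"
    and K: "K = card R * (\<rho> + 1) + \<rho> + 1"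
    and x: "\<not> commutes R \<alpha> (\<lambda>i. if i < k then x i else 0)"
  shows "\<exists>y. \<not> commutes R \<alpha> (\<lambda>i. if i < k then y i else 0) \<and>
     (\<forall>i. y i < 2 ^ 2 ^ (2 ^ card R * (2 * K + 1) ^ (card V + k)))"
proof -
  define rows :: "('v + nat) set" where "rows = V <+> {..<k}"
  define A :: "'v + nat \<Rightarrow> 'v crule \<Rightarrow> int" where 
    "A r p = (case r of Inl v \<Rightarrow> int (count (rhs p) v) - of_bool (lhs p = v) | Inr i \<Rightarrow> int (wt p i))" for r p
  define J :: "'v + nat \<Rightarrow> nat option" where "J r = (case r of Inl v \<Rightarrow> None | Inr i \<Rightarrow> Some i)" for r
  define \<beta> :: "'v + nat \<Rightarrow> int" where "\<beta> r = (case r of Inl v \<Rightarrow> int (count \<alpha> v) | Inr i \<Rightarrow> 0)" for r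
  \<comment> \<open>Counts on \<open>T\<close> are written as \<open>Suc (m p)\<close>, which forces
    \<open>T\<close> to be exactly the set of used rules; the guaranteed applications move into the
    constant.\<close>
  define b where "b T r = \<beta> r + (\<Sum>p\<in>T. A r p)" for T r
  define I where "I = {(T, b T) | T. T \<subseteq> R \<and> lhs ` T \<subseteq> reach T \<alpha>}"
  have sum_T: "\<beta> r + (\<Sum>p\<in>R. A r p * int (n p)) = b T r + (\<Sum>p\<in>T. A r p * int (m p))"
    if "T \<subseteq> R" "\<And>p. p \<in> T \<Longrightarrow> n p = Suc (m p)" "\<And>p. p \<in> R - T \<Longrightarrow> n p = 0" for T r n m
  proof -
    have "(\<Sum>p\<in>R. A r p * int (n p)) = (\<Sum>p\<in>T. A r p * int (n p))"
      by (rule sum.mono_neutral_right) (use that fin in auto)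
    also have "\<dots> = (\<Sum>p\<in>T. A r p + A r p * int (m p))"
      by (rule sum.cong) (use that in \<open>auto simp: algebra_simps\<close>)
    finally show ?thesis by (simp add: b_def sum.distrib)
  qed
  have rows_iff: "(\<forall>r\<in>rows. \<beta> r + (\<Sum>p\<in>R. A r p * int (n p)) = rhs_val J x r) \<longleftrightarrow>
      balanced R n \<alpha> \<and> (\<forall>i<k. x i = (\<Sum>p\<in>R. n p * wt p i))" for n x
  proof -
    have "(\<forall>r\<in>rows. \<beta> r + (\<Sum>p\<in>R. A r p * int (n p)) = rhs_val J x r) \<longleftrightarrow>
      (\<forall>v\<in>V. \<beta> (Inl v) + (\<Sum>p\<in>R. A (Inl v) p * int (n p)) = rhs_val J x (Inl v)) \<and>
      (\<forall>i<k. \<beta> (Inr i) + (\<Sum>p\<in>R. A (Inr i) p * int (n p)) = rhs_val J x (Inr i))"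
      by (auto simp: rows_def)
    moreover have "\<beta> (Inl v) + (\<Sum>p\<in>R. A (Inl v) p * int (n p)) = rhs_val J x (Inl v) \<longleftrightarrow>
      count \<alpha> v + (\<Sum>p\<in>R. n p * count (rhs p) v) = (\<Sum>p\<in>R. n p * of_bool (lhs p = v))" for v
    proof -
      have "\<beta> (Inl v) + (\<Sum>p\<in>R. A (Inl v) p * int (n p)) = 
        int (count \<alpha> v + (\<Sum>p\<in>R. n p * count (rhs p) v)) - int (\<Sum>p\<in>R. n p * of_bool (lhs p = v))"
        by (simp add: \<beta>_def A_def left_diff_distrib sum_subtractf) (simp add: mult.commute)
      then show ?thesis by (simp only: rhs_val_def J_def sum.case option.case right_minus_eq of_nat_eq_iff)
    qed
    moreover have "\<beta> (Inr i) + (\<Sum>p\<in>R. A (Inr i) p * int (n p)) = rhs_val J x (Inr i) \<longleftrightarrow>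
      x i = (\<Sum>p\<in>R. n p * wt p i)" for i
    proof -
      have "\<beta> (Inr i) + (\<Sum>p\<in>R. A (Inr i) p * int (n p)) = int (\<Sum>p\<in>R. n p * wt p i)"
        by (simp add: \<beta>_def A_def mult.commute)
      then show ?thesis by (simp only: rhs_val_def J_def sum.case option.case of_nat_eq_iff eq_commute[of _ "int (x i)"] eq_commute[of "\<Sum>p\<in>R. n p * wt p i" "x i"])
    qed
    moreover have "count \<alpha> v + (\<Sum>p\<in>R. n p * count (rhs p) v) = (\<Sum>p\<in>R. n p * of_bool (lhs p = v))" if "v \<notin> V" for v
    proof -
      have "count (rhs p) v = 0" "lhs p \<noteq> v" if "p \<in> R" for p
        using V(1,2)[OF that] \<open>v \<notin> V\<close> by (auto simp only: not_in_iff[symmetric])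
      moreover have "count \<alpha> v = 0" using V that by (auto simp only: not_in_iff[symmetric])
      ultimately show ?thesis by simp
    qed
    ultimately show ?thesis unfolding balanced_def by blast
  qed
  have M: "commutes R \<alpha> (\<lambda>i. if i < k then x i else 0) \<longleftrightarrow> x \<in> (\<Union>(T, c)\<in>I. solset rows J A T c)" for x
  proof
    assume "commutes R \<alpha> (\<lambda>i. if i < k then x i else 0)"
    then obtain n where n: "balanced R n \<alpha>" "lhs ` used R n \<subseteq> reach (used R n) \<alpha>" 
      "(\<lambda>i. if i < k then x i else 0) = (\<lambda>i. \<Sum>p\<in>R. n p * wt p i)"
      unfolding commutes_iff[OF fin(1)] by blast
    have "x i = (\<Sum>p\<in>R. n p * wt p i)" if "i < k" for i
      using fun_cong[OF n(3), of i] that by simp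
    then have rows: "\<forall>r\<in>rows. \<beta> r + (\<Sum>p\<in>R. A r p * int (n p)) = rhs_val J x r"
      using rows_iff n(1) by blast
    have eq: "\<beta> r + (\<Sum>p\<in>R. A r p * int (n p)) = b (used R n) r + (\<Sum>p\<in>used R n. A r p * int (n p - 1))" for r
      by (rule sum_T) (auto simp: used_def)
    have "x \<in> solset rows J A (used R n) (b (used R n))"
      unfolding solset_def using rows unfolding eq by (intro CollectI exI[of _ "\<lambda>p. n p - 1"])
    moreover have "(used R n, b (used R n)) \<in> I" using n(2) unfolding I_def by (auto simp: used_def)
    ultimately show "x \<in> (\<Union>(T, c)\<in>I. solset rows J A T c)" by blast
  next
    assume "x \<in> (\<Union>(T, c)\<in>I. solset rows J A T c)"
    then obtain T m where T: "T \<subseteq> R" "lhs ` T \<subseteq> reach T \<alpha>" 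
      and m: "\<forall>r\<in>rows. b T r + (\<Sum>p\<in>T. A r p * int (m p)) = rhs_val J x r"
      by (auto simp: I_def solset_def)
    define n where "n p = (if p \<in> T then Suc (m p) else 0)" for p
    have "\<beta> r + (\<Sum>p\<in>R. A r p * int (n p)) = b T r + (\<Sum>p\<in>T. A r p * int (m p))" for r
      by (rule sum_T) (use T in \<open>auto simp: n_def\<close>)
    then have "\<forall>r\<in>rows. \<beta> r + (\<Sum>p\<in>R. A r p * int (n p)) = rhs_val J x r"
      using m by (simp only:)
    then have "balanced R n \<alpha> \<and> (\<forall>i<k. x i = (\<Sum>p\<in>R. n p * wt p i))"
      unfolding rows_iff .
    moreover have "used R n = T" using T by (auto simp: used_def n_def)
    moreover have "(\<Sum>p\<in>R. n p * wt p i) = 0" if "\<not> i < k" for i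
      using wt(2) that by (intro sum.neutral) auto
    ultimately show "commutes R \<alpha> (\<lambda>i. if i < k then x i else 0)"
      unfolding commutes_iff[OF fin(1)] using T by (intro exI[of _ n]) auto
  qed
  have A_le: "\<bar>A r p\<bar> \<le> int (\<rho> + 1)" if "p \<in> R" for r p
  proof (cases r)
    case (Inl v)
    then show ?thesis using size(1)[OF that] count_le_size[of "rhs p" v] by (auto simp: A_def of_bool_def abs_le_iff)
  next
    case (Inr i)
    then show ?thesis using wt(1)[OF that, of i] by (simp add: A_def)
  qed
  have sum_A: "(\<Sum>p\<in>R. \<bar>A r p\<bar>) \<le> int (card R * (\<rho> + 1))" for r
    using sum_bounded_above[of R "\<lambda>p. \<bar>A r p\<bar>" "int (\<rho> + 1)"] A_le by (simp only: of_nat_mult of_nat_id)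
  \<comment> \<open>Cutting off at \<open>k\<close> leaves finitely many nonzero coordinates, so one
    number of digits suffices for all of them.\<close>
  let ?x = "\<lambda>i. if i < k then x i else 0"
  have "\<exists>j. \<forall>i<k. x i < 2 ^ j"
  proof -
    have "x i < 2 ^ (\<Sum>i<k. x i)" if "i < k" for i
      by (rule le_less_trans[OF member_le_sum less_exp]) (use that in auto)
    then show ?thesis by blast
  qed
  then obtain j where j: "\<forall>i. ?x i < 2 ^ j" by auto
  have "(\<lambda>i. if i < k then ?x i else 0) = ?x" by auto
  then have "?x \<notin> (\<Union>(T, c)\<in>I. solset rows J A T c)" using x M[of ?x] by simp
  moreover have "card rows = card V + k" using fin by (simp add: rows_def card_Plus)
  moreover have "finite rows" using fin by (simp add: rows_def)
  moreover have "(\<Sum>p\<in>R. \<bar>A r p\<bar>) + 1 \<le> int K" for r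
    using sum_A[of r] unfolding K by simp
  moreover have "T \<subseteq> R \<and> (\<forall>r\<in>rows. \<bar>c r\<bar> \<le> int K)" if "(T, c) \<in> I" for T c
  proof -
    have T: "T \<subseteq> R" "c = b T" using that by (auto simp: I_def)
    have "\<bar>b T r\<bar> \<le> int K" for r
    proof -
      have "\<bar>\<Sum>p\<in>T. A r p\<bar> \<le> (\<Sum>p\<in>R. \<bar>A r p\<bar>)"
        by (rule order.trans[OF sum_abs sum_mono2]) (use fin T in auto)
      moreover have "\<bar>\<beta> r\<bar> \<le> int \<rho>"
        using size(2) by (cases r) (auto simp: \<beta>_def intro: order.trans[OF count_le_size])
      ultimately show ?thesis using sum_A[of r] unfolding b_def K by simp
    qed
    then show ?thesis using T by simp
  qed
  ultimately have "\<exists>y. y \<notin> (\<Union>(T, c)\<in>I. solset rows J A T c) \<and> 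
    (\<forall>i. y i < 2 ^ 2 ^ (2 ^ card R * (2 * K + 1) ^ (card V + k)))"
    using solset_Union_bound[of rows R A K I ?x J j] fin(1) j by simp
  then show ?thesis unfolding M .
qed

section \<open>Intersection with a counting automaton, and the exponent bound\<close>

section \<open>Words with unknown exponents\<close>

definition blocks :: "(nat \<Rightarrow> 't list) \<Rightarrow> nat \<Rightarrow> (nat \<Rightarrow> nat) \<Rightarrow> nat \<Rightarrow> 't list" where
  "blocks us k x i = concat (map (\<lambda>j. concat (replicate (x j) (us j))) [i..<k])"

lemma blocks_end [simp]: "blocks us k x k = []"
  by (simp add: blocks_def)

lemma blocks_step: "i < k \<Longrightarrow> blocks us k x i = concat (replicate (x i) (us i)) @ blocks us k x (Suc i)"
  by (simp add: blocks_def upt_conv_Cons)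

lemma blocks_cong: "(\<And>j. i \<le> j \<Longrightarrow> j < k \<Longrightarrow> x j = y j) \<Longrightarrow> blocks us k x i = blocks us k y i"
  unfolding blocks_def by (intro arg_cong[of _ _ concat] map_cong) auto

text \<open>An automaton for \<open>z us\<^sub>0\<^sup>* \<dots> us\<^sub>k\<^sub>-\<^sub>1\<^sup>*\<close>. In state \<open>(i, r)\<close> the rest \<open>r\<close> of a copy of \<open>us i\<close>
  (or of \<open>z\<close>) remains to be read. Silent moves start a further copy of \<open>us i\<close>, which is counted,
  or proceed to the next block.\<close>

type_synonym 't state = "nat \<times> 't list"

inductive silent :: "(nat \<Rightarrow> 't list) \<Rightarrow> nat \<Rightarrow> 't state \<Rightarrow> (nat \<Rightarrow> nat) \<Rightarrow> 't state \<Rightarrow> bool" for us k where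
  silent_enter: "i < k \<Longrightarrow> silent us k (i, []) (\<lambda>j. of_bool (j = i)) (i, us i)"
| silent_skip: "i < k \<Longrightarrow> silent us k (i, []) (\<lambda>j. 0) (Suc i, [])"

inductive path :: "(nat \<Rightarrow> 't list) \<Rightarrow> nat \<Rightarrow> 't state \<Rightarrow> 't list \<Rightarrow> (nat \<Rightarrow> nat) \<Rightarrow> 't state \<Rightarrow> bool" for us k where
  path_refl: "path us k p [] (\<lambda>j. 0) p"
| path_silent: "silent us k p c p' \<Longrightarrow> path us k p' w x q \<Longrightarrow> path us k p w (\<lambda>j. c j + x j) q"
| path_letter: "path us k (i, r) w x q \<Longrightarrow> path us k (i, a # r) (a # w) x q"

lemma path_append:
  "path us k p w x p' \<Longrightarrow> path us k p' w' y q \<Longrightarrow> path us k p (w @ w') (\<lambda>j. x j + y j) q"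
proof (induction rule: path.induct)
  case (path_silent p c p' w x q)
  then show ?case using path.path_silent[OF path_silent(1)] by (fastforce simp: add.assoc)
qed (auto intro: path.intros)

lemma path_letters: "path us k (i, r) w x q \<Longrightarrow> path us k (i, u @ r) (u @ w) x q"
  by (induction u) (auto intro: path.intros)

text \<open>That \<open>x\<close> vanishes outside the remaining blocks is part of the induction:
  when block \<open>i\<close> is skipped, it makes the contribution of that block empty.\<close>

lemma path_imp_blocks:
  assumes "path us k (i, r) w x (k, [])"
  shows "i \<le> k \<and> w = r @ blocks us k x i \<and> (\<forall>j. j < i \<or> k \<le> j \<longrightarrow> x j = 0)"
  using assms
proof (induction "(i, r)" w x "(k, [] :: 'a list)" arbitrary: i r rule: path.induct)
  case (path_silent c p' w x)
  from path_silent(1) show ?case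
  proof cases
    case silent_enter
    then have x: "w = us i @ blocks us k x i" "\<forall>j. j < i \<or> k \<le> j \<longrightarrow> x j = 0"
      using path_silent(3)[of i "us i"] by auto
    moreover have "blocks us k (\<lambda>j. c j + x j) (Suc i) = blocks us k x (Suc i)"
      by (rule blocks_cong) (use silent_enter in auto)
    ultimately show ?thesis using silent_enter by (auto simp: blocks_step)
  next
    case silent_skip
    then have x: "w = blocks us k x (Suc i)" "\<forall>j. j < Suc i \<or> k \<le> j \<longrightarrow> x j = 0"
      using path_silent(3)[of "Suc i" "[]"] by auto
    then show ?thesis using silent_skip by (auto simp: blocks_step)
  qed
qed auto

text \<open>Downward induction on the block, and within a block induction on the number of copies
  still to be started.\<close>

lemma path_blocks:
  assumes "i \<le> k" "\<forall>j. j < i \<or> k \<le> j \<longrightarrow> x j = 0"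
  shows "path us k (i, []) (blocks us k x i) x (k, [])"
  using assms
proof (induction i arbitrary: x rule: inc_induct)
  case base
  then have "x = (\<lambda>j. 0)" by (auto simp: fun_eq_iff)
  then show ?case using path_refl[of us k "(k, [])"] by simp
next
  case (step i)
  from step.prems show ?case
  proof (induction "x i" arbitrary: x)
    case 0
    then have "path us k (Suc i, []) (blocks us k x (Suc i)) x (k, [])"
      by (intro step.IH) (metis less_SucE)
    from path_silent[OF silent_skip[OF step(2)] this] show ?case
      using 0 step(2) by (simp add: blocks_step)
  next
    case (Suc n)
    let ?x = "x(i := n)"
    have "path us k (i, us i) (us i @ blocks us k ?x i) ?x (k, [])"
    proof -
      have "path us k (i, []) (blocks us k ?x i) ?x (k, [])"
        by (rule Suc(1)) (use Suc.prems step(2) in auto)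
      from path_letters[OF this, of "us i"] show ?thesis by simp
    qed
    from path_silent[OF silent_enter[OF step(2)] this]
    have "path us k (i, []) (us i @ blocks us k ?x i) (\<lambda>j. of_bool (j = i) + ?x j) (k, [])" .
    moreover have "(\<lambda>j. of_bool (j = i) + ?x j) = x" using Suc(2) by auto
    moreover have "blocks us k ?x (Suc i) = blocks us k x (Suc i)" by (rule blocks_cong) auto
    ultimately show ?case using step(2) by (simp add: blocks_step Suc(2)[symmetric])
  qed
qed

subsection \<open>Intersecting the grammar with the automaton\<close>

type_synonym 't triple = "'t state \<times> (nat, 't) symbol \<times> 't state"

text \<open>The Bar-Hillel construction: a triple \<open>(p, s, q)\<close> stands for a word of
  \<open>s\<close> leading from \<open>p\<close> to \<open>q\<close>, and intermediate states are
  guessed. A multiset suffices since only counts of started copies matter.\<close>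

fun chains :: "'t state set \<Rightarrow> 't state \<Rightarrow> (nat, 't) symbol list \<Rightarrow> 't state \<Rightarrow> 't triple multiset set" where
  "chains Q p [] q = (if p = q then {{#}} else {})"
| "chains Q p (s # ss) q = (\<Union>p'\<in>Q. add_mset (p, s, p') ` chains Q p' ss q)"

lemma chains_Cons: "p' \<in> Q \<Longrightarrow> \<alpha> \<in> chains Q p' ss q \<Longrightarrow> add_mset (p, s, p') \<alpha> \<in> chains Q p (s # ss) q"
  by auto

lemma card_UN_bound:
  assumes "finite I" "card I \<le> b" "\<And>i. i \<in> I \<Longrightarrow> finite (f i) \<and> card (f i) \<le> c"
  shows "finite (\<Union>i\<in>I. f i) \<and> card (\<Union>i\<in>I. f i) \<le> b * c"
proof -
  have "card (\<Union>i\<in>I. f i) \<le> (\<Sum>i\<in>I. card (f i))" using assms by (simp add: card_UN_le)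
  also have "\<dots> \<le> (\<Sum>i\<in>I. c)" using assms(3) by (intro sum_mono) auto
  also have "\<dots> \<le> b * c" using assms(2) by simp
  finally show ?thesis using assms by auto
qed

lemma power_mono_nat: "1 \<le> a \<Longrightarrow> a \<le> b \<Longrightarrow> n \<le> m \<Longrightarrow> a ^ n \<le> (b::nat) ^ m"
  by (meson le_trans power_increasing power_mono zero_le)

locale block_automaton =
  fixes P :: "(nat, 't) productions" and us :: "nat \<Rightarrow> 't list" and k :: nat and z :: "'t list"
  assumes finite_P: "finite P"
begin

text \<open>A generous set of states: any block index may be combined with a suffix of any of the
  words. Closure under moves is then immediate and the states are easy to count.\<close>

definition Q :: "'t state set" where
  "Q = {(i, r). i \<le> k \<and> (\<exists>w\<in>insert z (us ` {..<k}). suffix r w)}"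

definition Sy :: "(nat, 't) symbol set" where
  "Sy = Nonterminal ` fst ` P \<union> (\<Union>(A, \<beta>)\<in>P. set \<beta>)"

definition prod_rules :: "'t triple crule set" where
  "prod_rules = (\<Union>(A, \<beta>)\<in>P. \<Union>p\<in>Q. \<Union>q\<in>Q. (\<lambda>\<alpha>. CRule (p, Nonterminal A, q) \<alpha> (\<lambda>j. 0)) ` chains Q p \<beta> q)"

definition letter_rules :: "'t triple crule set" where
  "letter_rules = {CRule ((i, a # r), Terminal a, (i, r)) {#} (\<lambda>j. 0) | i a r. 
     (i, a # r) \<in> Q \<and> (i, r) \<in> Q \<and> Terminal a \<in> Sy}"

text \<open>A silent move is charged to the triple of the symbol that comes next; these are the
  rules that carry weight.\<close>

definition silent_rules :: "'t triple crule set" where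
  "silent_rules = {CRule (p, s, q) {#(p', s, q)#} c | p s q p' c.
     p \<in> Q \<and> p' \<in> Q \<and> q \<in> Q \<and> s \<in> Sy \<and> silent us k p c p'}"

definition rules :: "'t triple crule set" where
  "rules = prod_rules \<union> letter_rules \<union> silent_rules"

abbreviation "pth \<equiv> path us k"

lemma Q_silent: "silent us k p c p' \<Longrightarrow> p \<in> Q \<Longrightarrow> p' \<in> Q"
  by (induction rule: silent.induct) (auto simp: Q_def)

lemma Q_letter: "(i, a # r) \<in> Q \<Longrightarrow> (i, r) \<in> Q"
  by (auto simp: Q_def dest: suffix_ConsD)

subsubsection \<open>Soundness\<close>

definition sem :: "'t triple \<Rightarrow> (nat \<Rightarrow> nat) \<Rightarrow> bool" where
  "sem v x \<longleftrightarrow> (case v of (p, s, q) \<Rightarrow> \<exists>w. gens P [s] w \<and> pth p w x q)"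

inductive sem_mset :: "'t triple multiset \<Rightarrow> (nat \<Rightarrow> nat) \<Rightarrow> bool" where
  sem_mset_empty: "sem_mset {#} (\<lambda>j. 0)"
| sem_mset_add: "sem v x \<Longrightarrow> sem_mset \<alpha> y \<Longrightarrow> sem_mset (add_mset v \<alpha>) (\<lambda>j. x j + y j)"

text \<open>The inductive definition builds the multiset in some order; exchanging two additions
  lets any member be taken out first.\<close>

lemma sem_mset_addD:
  assumes "sem_mset (add_mset v \<alpha>) z'"
  shows "\<exists>x y. sem v x \<and> sem_mset \<alpha> y \<and> z' = (\<lambda>j. x j + y j)"
  using assms
proof (induction "add_mset v \<alpha>" z' arbitrary: v \<alpha> rule: sem_mset.induct)
  case (sem_mset_add u x \<gamma> y)
  show ?case
  proof (cases "u = v")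
    case True
    then show ?thesis using sem_mset_add by auto
  next
    case False
    with sem_mset_add(4) obtain \<delta> where \<delta>: "\<gamma> = add_mset v \<delta>" "\<alpha> = add_mset u \<delta>"
      unfolding add_eq_conv_ex by blast
    from sem_mset_add(3)[OF \<delta>(1)] obtain x' y' where 1: "sem v x'" "sem_mset \<delta> y'" "y = (\<lambda>j. x' j + y' j)" by blast
    moreover from sem_mset.sem_mset_add[OF sem_mset_add(1) 1(2)] have "sem_mset \<alpha> (\<lambda>j. x j + y' j)"
      using \<delta> by simp
    moreover have "(\<lambda>j. x j + y j) = (\<lambda>j. x' j + (x j + y' j))" using 1 by auto
    ultimately show ?thesis by blast
  qed
qed simp

text \<open>Grammar rules rewrite inside a larger multiset, so the untouched rest \<gamma> is
  carried along while the paths of the chain are joined.\<close>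

lemma sem_chain:
  assumes "\<alpha> \<in> chains Q p ss q" "sem_mset (\<alpha> + \<gamma>) z'"
  shows "\<exists>w x y. gens P ss w \<and> pth p w x q \<and> sem_mset \<gamma> y \<and> z' = (\<lambda>j. x j + y j)"
  using assms
proof (induction ss arbitrary: p \<alpha> z')
  case Nil
  then have "\<alpha> = {#}" "p = q" by (auto split: if_splits)
  then show ?case using Nil path_refl[of us k p] by (intro exI[of _ "[]"] exI[of _ "\<lambda>j. 0"] exI[of _ z']) simp
next
  case (Cons s ss)
  then obtain p' \<alpha>' where p': "\<alpha> = add_mset (p, s, p') \<alpha>'" "\<alpha>' \<in> chains Q p' ss q" by auto
  with Cons.prems obtain x y where 1: "sem (p, s, p') x" "sem_mset (\<alpha>' + \<gamma>) y" "z' = (\<lambda>j. x j + y j)"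
    using sem_mset_addD[of "(p, s, p')" "\<alpha>' + \<gamma>" z'] by auto
  from Cons.IH[OF p'(2) 1(2)] obtain w x' y' where 2: "gens P ss w" "pth p' w x' q" "sem_mset \<gamma> y'" "y = (\<lambda>j. x' j + y' j)"
    by blast
  from 1 obtain u where u: "gens P [s] u" "pth p u x p'" by (auto simp: sem_def)
  have "gens P (s # ss) (u @ w)" using gens_append[OF u(1) 2(1)] by simp
  moreover have "pth p (u @ w) (\<lambda>j. x j + x' j) q" using path_append[OF u(2) 2(2)] .
  moreover have "z' = (\<lambda>j. x j + x' j + y' j)" using 1 2 by auto
  ultimately show ?case using 2(3) by blast
qed

lemma commutes_sem: "commutes rules \<alpha> x \<Longrightarrow> sem_mset \<alpha> x"
proof (induction rule: commutes.induct)
  case commutes_empty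
  show ?case by (rule sem_mset_empty)
next
  case (commutes_step \<pi> \<alpha> x)
  consider "\<pi> \<in> prod_rules" | "\<pi> \<in> letter_rules" | "\<pi> \<in> silent_rules"
    using commutes_step(1) by (auto simp: rules_def)
  then show ?case
  proof cases
    case 1
    then obtain A \<beta> p q \<gamma> where \<pi>: "(A, \<beta>) \<in> P" "\<gamma> \<in> chains Q p \<beta> q" "\<pi> = CRule (p, Nonterminal A, q) \<gamma> (\<lambda>j. 0)"
      by (auto simp: prod_rules_def)
    from sem_chain[OF \<pi>(2)] commutes_step(3) \<pi>(3) obtain w x' y 
      where w: "gens P \<beta> w" "pth p w x' q" "sem_mset \<alpha> y" "x = (\<lambda>j. x' j + y j)" by fastforce
    have "gens P [Nonterminal A] w" using \<pi>(1) w(1) by (auto simp: gens_Nonterminal_iff)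
    then have "sem (p, Nonterminal A, q) x'" using w(2) by (auto simp: sem_def)
    from sem_mset_add[OF this w(3)] show ?thesis using \<pi>(3) w(4) by simp
  next
    case 2
    then obtain i a r where \<pi>: "\<pi> = CRule ((i, a # r), Terminal a, (i, r)) {#} (\<lambda>j. 0)"
      by (auto simp: letter_rules_def)
    have "pth (i, a # r) [a] (\<lambda>j. 0) (i, r)" by (intro path_letter path_refl)
    then have "sem ((i, a # r), Terminal a, (i, r)) (\<lambda>j. 0)"
      by (auto simp: sem_def gens_Terminal_iff)
    from sem_mset_add[OF this commutes_step(3)] show ?thesis using \<pi> by simp
  next
    case 3
    then obtain p s q p' c where \<pi>: "silent us k p c p'" "\<pi> = CRule (p, s, q) {#(p', s, q)#} c"
      by (auto simp: silent_rules_def)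
    with commutes_step(3) sem_mset_addD[of "(p', s, q)" \<alpha> x] obtain x' y 
      where x: "sem (p', s, q) x'" "sem_mset \<alpha> y" "x = (\<lambda>j. x' j + y j)" by auto
    then obtain w where "gens P [s] w" "pth p' w x' q" by (auto simp: sem_def)
    moreover from path_silent[OF \<pi>(1) this(2)] have "pth p w (\<lambda>j. c j + x' j) q" .
    ultimately have "sem (p, s, q) (\<lambda>j. c j + x' j)" by (auto simp: sem_def)
    from sem_mset_add[OF this x(2)] show ?thesis using \<pi>(2) x(3) by (simp add: add.assoc)
  qed
qed

subsubsection \<open>Completeness\<close>

lemma commutes_union: 
  "commutes R \<alpha> x \<Longrightarrow> commutes R \<beta> y \<Longrightarrow> commutes R (\<alpha> + \<beta>) (\<lambda>j. x j + y j)"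
proof (induction rule: commutes.induct)
  case (commutes_step p \<alpha> x)
  then have "commutes R (rhs p + (\<alpha> + \<beta>)) (\<lambda>j. x j + y j)" by (simp add: add.assoc)
  from commutes.commutes_step[OF commutes_step(1) this] show ?case by (simp add: add.assoc)
qed simp

lemma commutes_single: "\<pi> \<in> R \<Longrightarrow> commutes R (rhs \<pi>) x \<Longrightarrow> commutes R {#lhs \<pi>#} (\<lambda>j. wt \<pi> j + x j)"
  using commutes_step[of \<pi> R "{#}" x] by simp

lemma commutes_silent:
  assumes "silent us k p c p'" "p \<in> Q" "q \<in> Q" "s \<in> Sy" "commutes rules {#(p', s, q)#} x"
  shows "commutes rules {#(p, s, q)#} (\<lambda>j. c j + x j)"
proof -
  have "CRule (p, s, q) {#(p', s, q)#} c \<in> rules"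
    using assms Q_silent[OF assms(1)] unfolding rules_def silent_rules_def by blast
  from commutes_single[OF this] show ?thesis using assms(5) by simp
qed

lemma commutes_prod:
  assumes "(A, \<beta>) \<in> P" "p \<in> Q" "q \<in> Q" "\<alpha> \<in> chains Q p \<beta> q" "commutes rules \<alpha> x"
  shows "commutes rules {#(p, Nonterminal A, q)#} x"
proof -
  have "CRule (p, Nonterminal A, q) \<alpha> (\<lambda>j. 0) \<in> prod_rules"
    using assms unfolding prod_rules_def by blast
  then have "CRule (p, Nonterminal A, q) \<alpha> (\<lambda>j. 0) \<in> rules" by (simp add: rules_def)
  from commutes_single[OF this] show ?thesis using assms(5) by simp
qed

text \<open>The path is cut directly after the letter. Silent moves before it enter the triple of
  the letter, and those after it stay with the remaining path.\<close>

lemma path_letter_split: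
  assumes "pth p (a # w) x q" "p \<in> Q" "Terminal a \<in> Sy"
  shows "\<exists>p'\<in>Q. \<exists>x1 x2. commutes rules {#(p, Terminal a, p')#} x1 \<and> pth p' w x2 q \<and> x = (\<lambda>j. x1 j + x2 j)"
  using assms
proof (induction p "a # w" x q rule: path.induct)
  case (path_silent p c p' x q)
  then obtain p'' x1 x2 where p'': "p'' \<in> Q" "commutes rules {#(p', Terminal a, p'')#} x1" "pth p'' w x2 q" "x = (\<lambda>j. x1 j + x2 j)"
    using Q_silent by blast
  then have "commutes rules {#(p, Terminal a, p'')#} (\<lambda>j. c j + x1 j)"
    using path_silent by (intro commutes_silent) auto
  moreover have "(\<lambda>j. c j + x j) = (\<lambda>j. c j + x1 j + x2 j)" using p''(4) by auto
  ultimately show ?case using p'' by blast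
next
  case (path_letter i r x q)
  then have Q: "(i, r) \<in> Q" using Q_letter by blast
  then have "CRule ((i, a # r), Terminal a, (i, r)) {#} (\<lambda>j. 0) \<in> rules"
    using path_letter by (auto simp: rules_def letter_rules_def)
  from commutes_single[OF this] have "commutes rules {#((i, a # r), Terminal a, (i, r))#} (\<lambda>j. 0)"
    by (simp add: commutes_empty)
  then show ?case using Q path_letter(1) by (intro bexI[of _ "(i, r)"] exI[of _ "\<lambda>j. 0"] exI[of _ x]) auto
qed

text \<open>The induction needs an unread remainder \<open>w'\<close>: trailing silent moves are
  passed on to whatever follows, and the cut state is determined along the way.\<close>

lemma gens_path_chain:
  assumes "gens P \<beta> w" "set \<beta> \<subseteq> Sy" "p \<in> Q" "pth p (w @ w') x q"
  shows "\<exists>p'\<in>Q. \<exists>\<alpha>\<in>chains Q p \<beta> p'. \<exists>x1 x2. commutes rules \<alpha> x1 \<and> pth p' w' x2 q \<and> x = (\<lambda>j. x1 j + x2 j)"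
  using assms
proof (induction arbitrary: p w' x rule: gens.induct)
  case gens_Nil
  then show ?case using commutes_empty[of rules] by (intro bexI[of _ p] bexI[of _ "{#}"] exI[of _ "\<lambda>j. 0"] exI[of _ x]) auto
next
  case (gens_Terminal \<beta> w a)
  from path_letter_split[of p a "w @ w'" x q] gens_Terminal.prems obtain p1 x1 x2 where 1: 
    "p1 \<in> Q" "commutes rules {#(p, Terminal a, p1)#} x1" "pth p1 (w @ w') x2 q" "x = (\<lambda>j. x1 j + x2 j)" by auto
  from gens_Terminal.IH[OF _ 1(1,3)] gens_Terminal.prems obtain p' \<alpha> y1 y2 where 2:
    "p' \<in> Q" "\<alpha> \<in> chains Q p1 \<beta> p'" "commutes rules \<alpha> y1" "pth p' w' y2 q" "x2 = (\<lambda>j. y1 j + y2 j)" by auto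
  have "add_mset (p, Terminal a, p1) \<alpha> \<in> chains Q p (Terminal a # \<beta>) p'" using 1 2 by auto
  moreover have "commutes rules (add_mset (p, Terminal a, p1) \<alpha>) (\<lambda>j. x1 j + y1 j)"
    using commutes_union[OF 1(2) 2(3)] by simp
  moreover have "x = (\<lambda>j. x1 j + y1 j + y2 j)" using 1 2 by auto
  ultimately show ?case using 2 by blast
next
  case (gens_Nonterminal A \<alpha> u \<beta> v)
  have "set \<alpha> \<subseteq> Sy" using gens_Nonterminal(1) by (auto simp: Sy_def)
  moreover have "pth p (u @ (v @ w')) x q" using gens_Nonterminal.prems by simp
  ultimately obtain p1 \<gamma> x1 x2 where 1: 
    "p1 \<in> Q" "\<gamma> \<in> chains Q p \<alpha> p1" "commutes rules \<gamma> x1" "pth p1 (v @ w') x2 q" "x = (\<lambda>j. x1 j + x2 j)" 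
    using gens_Nonterminal.IH(1) gens_Nonterminal.prems by blast
  from gens_Nonterminal.IH(2)[OF _ 1(1,4)] gens_Nonterminal.prems obtain p' \<delta> y1 y2 where 2:
    "p' \<in> Q" "\<delta> \<in> chains Q p1 \<beta> p'" "commutes rules \<delta> y1" "pth p' w' y2 q" "x2 = (\<lambda>j. y1 j + y2 j)" by auto
  have "commutes rules {#(p, Nonterminal A, p1)#} x1"
    using gens_Nonterminal 1 by (intro commutes_prod) auto
  then have "commutes rules (add_mset (p, Nonterminal A, p1) \<delta>) (\<lambda>j. x1 j + y1 j)"
    using commutes_union[OF _ 2(3)] by fastforce
  moreover have "add_mset (p, Nonterminal A, p1) \<delta> \<in> chains Q p (Nonterminal A # \<beta>) p'" using 1 2 by auto
  moreover have "x = (\<lambda>j. x1 j + y1 j + y2 j)" using 1 2 by auto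
  ultimately show ?case using 2 by blast
qed

lemma path_Nil_commutes:
  assumes "pth p [] x q" "p \<in> Q" "q \<in> Q" "(Z, []) \<in> P"
  shows "commutes rules {#(p, Nonterminal Z, q)#} x"
  using assms
proof (induction p "[] :: 't list" x q rule: path.induct)
  case (path_refl p)
  then show ?case by (intro commutes_prod[OF path_refl(3)]) (auto intro: commutes_empty)
next
  case (path_silent p c p' x q)
  have "Nonterminal Z \<in> Sy" using path_silent by (force simp: Sy_def)
  with path_silent Q_silent[OF path_silent(1)] show ?case by (intro commutes_silent) auto
qed

text \<open>The nonterminal \<open>Z\<close> absorbs the silent moves at the end of a path.\<close>

theorem commutes_iff_gens:
  assumes "(S', [Nonterminal S, Nonterminal Z]) \<in> P" "(Z, []) \<in> P" "\<And>\<beta>. (S', \<beta>) \<in> P \<Longrightarrow> \<beta> = [Nonterminal S, Nonterminal Z]"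
    "\<And>\<beta>. (Z, \<beta>) \<in> P \<Longrightarrow> \<beta> = []"
  shows "commutes rules {#((0, z), Nonterminal S', (k, []))#} (\<lambda>j. if j < k then x j else 0) \<longleftrightarrow>
    gens P [Nonterminal S] (z @ blocks us k x 0)"
proof -
  let ?x = "\<lambda>j. if j < k then x j else 0"
  have blocks: "blocks us k ?x 0 = blocks us k x 0" by (rule blocks_cong) simp
  have Q: "(0, z) \<in> Q" "(k, []) \<in> Q" by (auto simp: Q_def)
  show ?thesis
  proof
    assume "commutes rules {#((0, z), Nonterminal S', (k, []))#} ?x"
    from commutes_sem[OF this] sem_mset_addD[of "((0, z), Nonterminal S', (k, []))" "{#}" ?x]
    obtain x' y where x': "sem ((0, z), Nonterminal S', (k, [])) x'" "sem_mset {#} y" "?x = (\<lambda>j. x' j + y j)"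
      by auto
    from x'(2) have "y = (\<lambda>j. 0)" by cases auto
    with x' have "sem ((0, z), Nonterminal S', (k, [])) ?x" by simp
    then obtain w where w: "gens P [Nonterminal S'] w" "pth (0, z) w ?x (k, [])"
      by (auto simp: sem_def)
    from path_imp_blocks[OF w(2)] blocks have w_eq: "w = z @ blocks us k x 0" by simp
    from w(1) have "gens P [Nonterminal S, Nonterminal Z] w"
      using assms(3) by (auto simp: gens_Nonterminal_iff[of P S'])
    then obtain u v where "w = u @ v" "gens P [Nonterminal S] u" "gens P [Nonterminal Z] v"
      using gens_append_iff[of P "[Nonterminal S]" "[Nonterminal Z]" w] by auto
    moreover have "v = []"
    proof -
      obtain \<gamma> where "(Z, \<gamma>) \<in> P" "gens P \<gamma> v"
        using calculation(3) by (auto simp: gens_Nonterminal_iff)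
      with assms(4) show ?thesis by fastforce
    qed
    ultimately show "gens P [Nonterminal S] (z @ blocks us k x 0)" using w_eq by simp
  next
    assume gens: "gens P [Nonterminal S] (z @ blocks us k x 0)"
    have "pth (0, []) (blocks us k ?x 0) ?x (k, [])" by (rule path_blocks) auto
    then have "pth (0, z) ((z @ blocks us k x 0) @ []) ?x (k, [])"
      using path_letters[of us k 0 "[]"] blocks by fastforce
    moreover have "set [Nonterminal S] \<subseteq> Sy" using assms(1) by (force simp: Sy_def)
    ultimately obtain p' \<alpha> x1 x2 where *: "p' \<in> Q" "\<alpha> \<in> chains Q (0, z) [Nonterminal S] p'" 
      "commutes rules \<alpha> x1" "pth p' [] x2 (k, [])" "?x = (\<lambda>j. x1 j + x2 j)"
      using gens_path_chain[OF gens _ Q(1)] by blast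
    then have \<alpha>: "\<alpha> = {#((0, z), Nonterminal S, p')#}" by (auto split: if_splits)
    have "commutes rules {#(p', Nonterminal Z, (k, []))#} x2"
      using path_Nil_commutes[OF *(4,1) Q(2) assms(2)] .
    from commutes_union[OF *(3) this] have "commutes rules {#((0, z), Nonterminal S, p'), (p', Nonterminal Z, (k, []))#} ?x"
      unfolding *(5) \<alpha> by (simp add: add_mset_commute)
    moreover have "{#((0, z), Nonterminal S, p'), (p', Nonterminal Z, (k, []))#} \<in> chains Q (0, z) [Nonterminal S, Nonterminal Z] (k, [])"
      by (intro chains_Cons *(1) Q) simp
    ultimately show "commutes rules {#((0, z), Nonterminal S', (k, []))#} ?x"
      using commutes_prod[OF assms(1) Q] by blast
  qed
qed

subsubsection \<open>Size bounds\<close>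

text \<open>There are \<open>k + 1\<close> block indices and at most \<open>k + 1\<close> words,
  each with at most \<open>L + 1\<close> suffixes.\<close>

lemma finite_Q: "finite Q"
  and card_Q: "(\<And>i. i < k \<Longrightarrow> length (us i) \<le> L) \<Longrightarrow> length z \<le> L \<Longrightarrow> card Q \<le> (k + 1) * ((k + 1) * (L + 1))"
proof -
  let ?W = "insert z (us ` {..<k})"
  have suffixes: "finite {r. suffix r w}" "card {r. suffix r w} \<le> length w + 1" for w :: "'t list"
    using card_length[of "suffixes w"] by (simp_all add: set_suffixes_eq[symmetric])
  have sub: "Q \<subseteq> {..k} \<times> (\<Union>w\<in>?W. {r. suffix r w})" by (auto simp: Q_def)
  then show "finite Q" by (rule finite_subset) (auto simp: suffixes)
  assume L: "\<And>i. i < k \<Longrightarrow> length (us i) \<le> L" "length z \<le> L"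
  have "card ?W \<le> k + 1"
    using card_image_le[of "{..<k}" us] by (intro order.trans[OF card_insert_le_m1]) auto
  have "card {r. suffix r w} \<le> L + 1" if "w \<in> ?W" for w
    using suffixes(2)[of w] L that by (fastforce intro: order.trans)
  then have "card (\<Union>w\<in>?W. {r. suffix r w}) \<le> (k + 1) * (L + 1)"
    using card_UN_bound[of ?W "k + 1" "\<lambda>w. {r. suffix r w}" "L + 1"] \<open>card ?W \<le> k + 1\<close> suffixes(1) by blast
  then have "card ({..k} \<times> (\<Union>w\<in>?W. {r. suffix r w})) \<le> (k + 1) * ((k + 1) * (L + 1))"
    unfolding card_cartesian_product card_atMost Suc_eq_plus1 by (rule mult_le_mono2)
  then show "card Q \<le> (k + 1) * ((k + 1) * (L + 1))"
    using card_mono[OF _ sub] suffixes by (meson finite_SigmaI finite_UN_I finite_atMost finite_imageI finite_insert finite_lessThan le_trans)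
qed

lemma finite_Sy: "finite Sy"
  using finite_P by (auto simp: Sy_def)

lemma chains_size: "\<alpha> \<in> chains Q' p ss q \<Longrightarrow> size \<alpha> = length ss"
  by (induction ss arbitrary: p \<alpha>) (auto split: if_splits)

lemma chains_set: "\<alpha> \<in> chains Q' p ss q \<Longrightarrow> p \<in> Q' \<Longrightarrow> set_mset \<alpha> \<subseteq> Q' \<times> set ss \<times> Q'"
  by (induction ss arbitrary: p \<alpha>) (fastforce split: if_splits)+

lemma chains_card:
  assumes "finite Q'" "card Q' \<le> m"
  shows "finite (chains Q' p ss q) \<and> card (chains Q' p ss q) \<le> m ^ length ss"
proof (induction ss arbitrary: p)
  case (Cons s ss)
  have "finite (add_mset (p, s, p') ` chains Q' p' ss q) \<and> card (add_mset (p, s, p') ` chains Q' p' ss q) \<le> m ^ length ss" for p'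
    using Cons[of p'] by (meson card_image_le finite_imageI le_trans)
  from card_UN_bound[OF assms this] show ?case by simp
qed simp

context
  fixes m \<rho> :: nat
  assumes m: "card Q \<le> m" "1 \<le> m" and \<rho>: "1 \<le> \<rho>" "\<And>A \<beta>. (A, \<beta>) \<in> P \<Longrightarrow> length \<beta> \<le> \<rho>"
begin

text \<open>A production contributes at most \<open>m * m\<close> pairs of end states and, for each
  pair, at most \<open>m ^ \<rho>\<close> chains.\<close>

lemma card_prod_rules: "finite prod_rules \<and> card prod_rules \<le> card P * m ^ (\<rho> + 2)"
proof -
  let ?r = "\<lambda>A \<beta> p q. (\<lambda>\<alpha>. CRule (p, Nonterminal A, q) \<alpha> (\<lambda>j. 0)) ` chains Q p \<beta> q"
  have 1: "finite (?r A \<beta> p q) \<and> card (?r A \<beta> p q) \<le> m ^ \<rho>" if "(A, \<beta>) \<in> P" for A \<beta> p q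
  proof -
    have "card (?r A \<beta> p q) \<le> m ^ length \<beta>"
      using chains_card[OF finite_Q m(1), of p \<beta> q] by (meson card_image_le le_trans)
    also have "\<dots> \<le> m ^ \<rho>" using \<rho>(2)[OF that] m(2) by (rule power_increasing)
    finally show ?thesis using chains_card[OF finite_Q m(1), of p \<beta> q] by simp
  qed
  have 2: "finite (\<Union>p\<in>Q. \<Union>q\<in>Q. ?r A \<beta> p q) \<and> card (\<Union>p\<in>Q. \<Union>q\<in>Q. ?r A \<beta> p q) \<le> m * (m * m ^ \<rho>)" 
    if "(A, \<beta>) \<in> P" for A \<beta>
    by (intro card_UN_bound finite_Q m(1) 1[OF that])
  have "finite prod_rules \<and> card prod_rules \<le> card P * (m * (m * m ^ \<rho>))"
    unfolding prod_rules_def by (rule card_UN_bound[OF finite_P order_refl]) (simp only: split_paired_all case_prod_conv 2)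
  then show ?thesis by (simp add: power2_eq_square algebra_simps)
qed

lemma card_V: "card (Q \<times> Sy \<times> Q) \<le> m\<^sup>2 * card Sy"
proof -
  have "card (Q \<times> Sy \<times> Q) = card Q * card Q * card Sy" by (simp add: card_cartesian_product)
  also have "\<dots> \<le> m * m * card Sy" using m by (intro mult_mono) auto
  finally show ?thesis by (simp add: power2_eq_square)
qed

lemma card_letter_rules: "finite letter_rules \<and> card letter_rules \<le> m\<^sup>2 * card Sy"
proof -
  have fin: "finite (Q \<times> Sy \<times> Q)" using finite_Q finite_Sy by simp
  have sub: "letter_rules \<subseteq> (\<lambda>v. CRule v {#} (\<lambda>j. 0)) ` (Q \<times> Sy \<times> Q)"
    by (auto simp: letter_rules_def)
  have "card letter_rules \<le> card (Q \<times> Sy \<times> Q)"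
    using surj_card_le[OF fin sub] .
  then show ?thesis using finite_subset[OF sub] fin card_V by auto
qed

text \<open>From a given state there is at most one entering and one skipping move, and the move
  fixes target and weight. A boolean together with the left-hand side therefore determines the
  rule.\<close>

lemma card_silent_rules: "finite silent_rules \<and> card silent_rules \<le> 2 * (m\<^sup>2 * card Sy)"
proof -
  let ?D = "UNIV \<times> Q \<times> Sy \<times> Q :: (bool \<times> 't triple) set"
  let ?f = "\<lambda>(b, (p, s, q)). if b then CRule (p, s, q) {#((fst p, us (fst p)), s, q)#} (\<lambda>j. of_bool (j = fst p))
      else CRule (p, s, q) {#((Suc (fst p), []), s, q)#} (\<lambda>j. 0)"
  have fin: "finite ?D" using finite_Q finite_Sy by simp
  have sub: "silent_rules \<subseteq> ?f ` ?D"
  proof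
    fix \<pi> assume "\<pi> \<in> silent_rules"
    then obtain p s q p' c where *: "\<pi> = CRule (p, s, q) {#(p', s, q)#} c" "p \<in> Q" "q \<in> Q" "s \<in> Sy" "silent us k p c p'"
      unfolding silent_rules_def by blast
    from *(5) have "\<pi> = ?f (True, (p, s, q)) \<or> \<pi> = ?f (False, (p, s, q))"
      using *(1) by cases auto
    then show "\<pi> \<in> ?f ` ?D" using * by blast
  qed
  have "card silent_rules \<le> card ?D" using surj_card_le[OF fin sub] .
  also have "\<dots> = 2 * card (Q \<times> Sy \<times> Q)" by (simp add: card_cartesian_product[of UNIV])
  finally show ?thesis using finite_subset[OF sub] fin card_V by auto
qed

lemma card_rules: "finite rules \<and> card rules \<le> card P * m ^ (\<rho> + 2) + 3 * (m\<^sup>2 * card Sy)"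
  unfolding rules_def using card_prod_rules card_letter_rules card_silent_rules
    card_Un_le[of "prod_rules \<union> letter_rules" silent_rules] card_Un_le[of prod_rules letter_rules]
  by auto

lemma rules_wf:
  assumes "\<pi> \<in> rules"
  shows "lhs \<pi> \<in> Q \<times> Sy \<times> Q" "set_mset (rhs \<pi>) \<subseteq> Q \<times> Sy \<times> Q" "size (rhs \<pi>) \<le> \<rho>" 
    "wt \<pi> i \<le> 1" "k \<le> i \<Longrightarrow> wt \<pi> i = 0"
proof -
  consider "\<pi> \<in> prod_rules" | "\<pi> \<in> letter_rules" | "\<pi> \<in> silent_rules"
    using assms by (auto simp: rules_def)
  then have "lhs \<pi> \<in> Q \<times> Sy \<times> Q \<and> set_mset (rhs \<pi>) \<subseteq> Q \<times> Sy \<times> Q \<and> size (rhs \<pi>) \<le> \<rho> \<and>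
     wt \<pi> i \<le> 1 \<and> (k \<le> i \<longrightarrow> wt \<pi> i = 0)"
  proof cases
    case 1
    then obtain A \<beta> p q \<gamma> where \<pi>: "(A, \<beta>) \<in> P" "p \<in> Q" "q \<in> Q" "\<gamma> \<in> chains Q p \<beta> q" "\<pi> = CRule (p, Nonterminal A, q) \<gamma> (\<lambda>j. 0)"
      by (auto simp: prod_rules_def)
    have "set \<beta> \<subseteq> Sy" "Nonterminal A \<in> Sy" using \<pi>(1) by (force simp: Sy_def)+
    then have "set_mset \<gamma> \<subseteq> Q \<times> Sy \<times> Q" using chains_set[OF \<pi>(4,2)] by blast
    then show ?thesis using \<pi> chains_size[OF \<pi>(4)] \<rho>(2) \<open>Nonterminal A \<in> Sy\<close> by simp
  next
    case 2
    then show ?thesis by (auto simp: letter_rules_def)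
  next
    case 3
    then obtain p s q p' c where *: "\<pi> = CRule (p, s, q) {#(p', s, q)#} c" "p \<in> Q" "p' \<in> Q" "q \<in> Q" "s \<in> Sy" "silent us k p c p'"
      unfolding silent_rules_def by blast
    from *(6) have "c i \<le> 1 \<and> (k \<le> i \<longrightarrow> c i = 0)" by cases auto
    then show ?thesis using * \<rho>(1) by simp
  qed
  then show "lhs \<pi> \<in> Q \<times> Sy \<times> Q" "set_mset (rhs \<pi>) \<subseteq> Q \<times> Sy \<times> Q" "size (rhs \<pi>) \<le> \<rho>" 
    "wt \<pi> i \<le> 1" "k \<le> i \<Longrightarrow> wt \<pi> i = 0" by auto
qed

end

end

text \<open>The bound of \<open>commutes_bound\<close> with all cardinalities estimated, for
  \<open>a\<close> productions with right-hand sides of length at most \<rho>, \<open>s\<close>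
  symbols, \<open>m\<close> states and \<open>k\<close> blocks. The summand
  \<open>3 * (m ^ 2 * s)\<close> covers one letter rule and two silent rules per triple.\<close>

definition exponent_bound :: "nat \<Rightarrow> nat \<Rightarrow> nat \<Rightarrow> nat \<Rightarrow> nat \<Rightarrow> nat" where
  "exponent_bound a \<rho> s m k = 
    2 ^ 2 ^ (2 ^ (a * m ^ (\<rho> + 2) + 3 * (m ^ 2 * s)) * 
      (2 * ((a * m ^ (\<rho> + 2) + 3 * (m ^ 2 * s)) * (\<rho> + 1) + \<rho> + 1) + 1) ^ (m ^ 2 * s + k))"

lemma gens_mono: "gens P \<beta> w \<Longrightarrow> P \<subseteq> P' \<Longrightarrow> gens P' \<beta> w"
  by (induction rule: gens.induct) (auto intro: gens.intros)

lemma gens_fresh: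
  assumes "gens (P \<union> P') \<beta> w" "set \<beta> \<inter> Nonterminal ` fst ` P' = {}" 
    "\<And>A \<alpha>. (A, \<alpha>) \<in> P \<Longrightarrow> set \<alpha> \<inter> Nonterminal ` fst ` P' = {}"
  shows "gens P \<beta> w"
  using assms(1,2)
proof (induction rule: gens.induct)
  case (gens_Nonterminal A \<alpha> u \<beta> v)
  then have "(A, \<alpha>) \<in> P" by force
  then show ?case using gens_Nonterminal assms(3) by (auto intro: gens.intros)
qed (auto intro: gens.intros)

text \<open>The constants depend on the grammar alone and are fixed before the words are given. This
  uniformity turns the bound into a recursive function of the instance.\<close>

theorem exponent_bound:
  fixes P :: "(nat, 't) productions"
  assumes P: "finite P"
  obtains a \<rho> s where "\<And>us k z L x. (\<And>i. i < k \<Longrightarrow> length (us i) \<le> L) \<Longrightarrow> length z \<le> L \<Longrightarrow>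
    z @ blocks us k x 0 \<notin> language_of P S \<Longrightarrow>
    \<exists>y. z @ blocks us k y 0 \<notin> language_of P S \<and> (\<forall>i. y i < exponent_bound a \<rho> s ((k + 1) * ((k + 1) * (L + 1))) k)"
proof -
  let ?symb = "insert (Nonterminal S) (Nonterminal ` fst ` P \<union> (\<Union>(A, \<beta>)\<in>P. set \<beta>))"
  have "finite ?symb" using P by auto
  then have "finite {A. Nonterminal A \<in> ?symb}"
    using finite_vimageI[of ?symb Nonterminal] by (simp add: inj_on_def vimage_def)
  \<comment> \<open>All nonterminals lie below \<open>b\<close>, so \<open>b\<close> and
    \<open>Suc b\<close> are fresh: \<open>b\<close> absorbs final silent moves and
    \<open>Suc b\<close> becomes the start symbol.\<close>
  then obtain b where b: "\<And>A. Nonterminal A \<in> ?symb \<Longrightarrow> A < b"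
    unfolding finite_nat_set_iff_bounded by blast
  then have fresh: "Nonterminal b \<notin> ?symb" "Nonterminal (Suc b) \<notin> ?symb"
    using b[of b] b[of "Suc b"] by linarith+
  have not_lhs: "(b, \<beta>) \<notin> P" "(Suc b, \<beta>) \<notin> P" for \<beta>
    using fresh image_eqI[of b fst "(b, \<beta>)" P] image_eqI[of "Suc b" fst "(Suc b, \<beta>)" P] by auto
  have not_rhs: "Nonterminal b \<notin> set \<beta>" "Nonterminal (Suc b) \<notin> set \<beta>" if "(A, \<beta>) \<in> P" for A \<beta>
    using fresh that by blast+
  have not_S: "S \<noteq> b" "S \<noteq> Suc b" using fresh by blast+
  define P' where "P' = P \<union> {(Suc b, [Nonterminal S, Nonterminal b]), (b, [])}"
  have P': "finite P'" using P by (simp add: P'_def)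
  \<comment> \<open>The successor ensures that \<rho> is at least 1, the size of the start multiset
    and of the right-hand sides of silent rules.\<close>
  define \<rho> where "\<rho> = Suc (\<Sum>(A, \<beta>)\<in>P'. length \<beta>)"
  have \<rho>: "length \<beta> \<le> \<rho>" if "(A, \<beta>) \<in> P'" for A \<beta>
    using member_le_sum[OF that, of "\<lambda>(A, \<beta>). length \<beta>"] P' by (simp add: \<rho>_def)
  define s where "s = card (Nonterminal ` fst ` P' \<union> (\<Union>(A, \<beta>)\<in>P'. set \<beta>) :: (nat, 't) symbol set)"
  show thesis
  proof (rule that[of "card P'" \<rho> s])
    fix us :: "nat \<Rightarrow> 't list" and k z L x
    assume L: "\<And>i. i < k \<Longrightarrow> length (us i) \<le> L" "length z \<le> L" and x: "z @ blocks us k x 0 \<notin> language_of P S"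
    interpret block_automaton P' us k z by unfold_locales (rule P')
    define m where "m = (k + 1) * ((k + 1) * (L + 1))"
    have m: "card Q \<le> m" "1 \<le> m" using card_Q[OF L] by (simp_all add: m_def)
    have s: "card Sy = s" by (simp add: s_def Sy_def)
    have \<rho>1: "1 \<le> \<rho>" by (simp add: \<rho>_def)
    note bounds = card_rules[OF m \<rho>1 \<rho>] card_V[OF m \<rho>1 \<rho>] 
    note wf = rules_wf[OF m \<rho>1 \<rho>]
    let ?K = "card rules * (\<rho> + 1) + \<rho> + 1" and ?v = "((0, z), Nonterminal (Suc b), (k, []))"
    have iff: "commutes rules {#?v#} (\<lambda>j. if j < k then y j else 0) \<longleftrightarrow> z @ blocks us k y 0 \<in> language_of P S" for y
    proof -
      have "commutes rules {#?v#} (\<lambda>j. if j < k then y j else 0) \<longleftrightarrow> gens P' [Nonterminal S] (z @ blocks us k y 0)"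
        by (rule commutes_iff_gens[where Z = b]) (simp_all add: P'_def not_lhs)
      also have "\<dots> \<longleftrightarrow> gens P [Nonterminal S] (z @ blocks us k y 0)"
      proof
        assume "gens P' [Nonterminal S] (z @ blocks us k y 0)"
        then show "gens P [Nonterminal S] (z @ blocks us k y 0)"
          unfolding P'_def by (rule gens_fresh) (use not_S in \<open>auto dest: not_rhs\<close>)
      next
        assume "gens P [Nonterminal S] (z @ blocks us k y 0)"
        then show "gens P' [Nonterminal S] (z @ blocks us k y 0)"
          by (rule gens_mono) (auto simp: P'_def)
      qed
      finally show ?thesis by (simp add: language_of_gens)
    qed
    have "Nonterminal (Suc b) \<in> Sy" unfolding Sy_def by (force simp: P'_def)
    then have v: "?v \<in> Q \<times> Sy \<times> Q" by (auto simp: Q_def)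
    have "\<exists>y. \<not> commutes rules {#?v#} (\<lambda>i. if i < k then y i else 0) \<and>
       (\<forall>i. y i < 2 ^ 2 ^ (2 ^ card rules * (2 * ?K + 1) ^ (card (Q \<times> Sy \<times> Q) + k)))"
    proof (rule commutes_bound[where \<rho> = \<rho>])
      show "finite (Q \<times> Sy \<times> Q)" using finite_Q finite_Sy by simp
      show "\<not> commutes rules {#?v#} (\<lambda>i. if i < k then x i else 0)" using x iff by simp
    qed (use bounds wf \<rho>1 v in auto)
    moreover have "(2::nat) ^ 2 ^ (2 ^ card rules * (2 * ?K + 1) ^ (card (Q \<times> Sy \<times> Q) + k)) \<le> exponent_bound (card P') \<rho> s m k"
      unfolding exponent_bound_def using bounds s
      by (intro power_mono_nat mult_mono add_mono) auto
    ultimately show "\<exists>y. z @ blocks us k y 0 \<notin> language_of P S \<and> 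
        (\<forall>i. y i < exponent_bound (card P') \<rho> s ((k + 1) * ((k + 1) * (L + 1))) k)"
      unfolding iff m_def[symmetric] by (meson less_le_trans)
  qed
qed

section \<open>Values of words and the knapsack equation as triviality of one word\<close>

section \<open>Words over generators\<close>

context group
begin

lemma sym_alphabet_carrier: "\<Sigma> \<subseteq> carrier G \<Longrightarrow> sym_alphabet G \<Sigma> \<subseteq> carrier G"
  by (auto simp: sym_alphabet_def)

lemma word_val_Nil [simp]: "word_val G [] = \<one>"
  and word_val_Cons [simp]: "word_val G (a # w) = a \<otimes> word_val G w"
  by (simp_all add: word_val_def)

lemma word_val_closed: "set w \<subseteq> carrier G \<Longrightarrow> word_val G w \<in> carrier G"
  by (induction w) auto

lemma word_val_append:
  "set u \<subseteq> carrier G \<Longrightarrow> set v \<subseteq> carrier G \<Longrightarrow> word_val G (u @ v) = word_val G u \<otimes> word_val G v"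
  by (induction u) (auto simp: word_val_closed m_assoc)

lemma word_val_concat:
  "(\<And>w. w \<in> set ws \<Longrightarrow> set w \<subseteq> carrier G) \<Longrightarrow> word_val G (concat ws) = foldr (\<otimes>) (map (word_val G) ws) \<one>"
proof (induction ws)
  case (Cons w ws)
  then have "word_val G (concat (w # ws)) = word_val G w \<otimes> word_val G (concat ws)"
    using word_val_append[of w "concat ws"] by fastforce
  then show ?case using Cons by simp
qed simp

lemma word_val_power:
  assumes "set u \<subseteq> carrier G"
  shows "word_val G (concat (replicate n u)) = word_val G u [^] n"
proof (induction n)
  case (Suc n)
  have "set (concat (replicate n u)) \<subseteq> carrier G" using assms by auto
  then show ?case using Suc assms nat_pow_Suc2[OF word_val_closed[OF assms], of n]
    by (simp add: word_val_append)
qed simp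

lemma word_val_concat_map:
  assumes "set w \<subseteq> A" "\<And>a. a \<in> A \<Longrightarrow> set (t a) \<subseteq> carrier G \<and> word_val G (t a) = f a"
  shows "word_val G (concat (map t w)) = word_val G (map f w)"
  using assms(1)
proof (induction w)
  case (Cons a w)
  have "set (concat (map t w)) \<subseteq> carrier G" using Cons(2) assms(2) by fastforce
  then show ?case using Cons assms(2)[of a] by (simp add: word_val_append)
qed simp

lemma word_val_inverses:
  "set w \<subseteq> carrier G \<Longrightarrow> word_val G (map (m_inv G) (rev w)) = inv (word_val G w)"
proof (induction w)
  case (Cons a w)
  have "set (map (m_inv G) (rev w)) \<subseteq> carrier G" using Cons by auto
  then show ?case using Cons by (simp add: word_val_append inv_mult_group word_val_closed)
qed simp

lemma generate_words:
  assumes "g \<in> generate G \<Sigma>" "\<Sigma> \<subseteq> carrier G"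
  shows "\<exists>w\<in>lists (sym_alphabet G \<Sigma>). word_val G w = g"
  using assms(1)
proof (induction rule: generate.induct)
  case one
  then show ?case by (intro bexI[of _ "[]"]) auto
next
  case (incl h)
  then show ?case using assms(2) by (intro bexI[of _ "[h]"]) (auto simp: sym_alphabet_def)
next
  case (inv h)
  then show ?case using assms(2) by (intro bexI[of _ "[inv h]"]) (auto simp: sym_alphabet_def)
next
  case (eng h1 h2)
  then obtain u v where "u \<in> lists (sym_alphabet G \<Sigma>)" "word_val G u = h1"
    "v \<in> lists (sym_alphabet G \<Sigma>)" "word_val G v = h2" by blast
  then show ?case using sym_alphabet_carrier[OF assms(2)]
    by (intro bexI[of _ "u @ v"]) (auto simp: word_val_append in_lists_conv_set subset_iff)
qed

lemma inv_mult_eq_one_iff: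
  assumes "a \<in> carrier G" "b \<in> carrier G"
  shows "inv a \<otimes> b = \<one> \<longleftrightarrow> a = b"
proof
  assume "inv a \<otimes> b = \<one>"
  then have "inv b = inv a" by (rule inv_equality) (use assms in auto)
  then have "inv (inv b) = inv (inv a)" by (rule arg_cong)
  then show "a = b" using assms by simp
qed (use assms in simp)

lemma word_val_blocks:
  assumes "\<And>j. j < k \<Longrightarrow> set (us j) \<subseteq> carrier G"
  shows "word_val G (blocks us k x 0) = foldr (\<otimes>) (map (\<lambda>j. word_val G (us j) [^] x j) [0..<k]) \<one>"
proof -
  have "word_val G (blocks us k x 0) = foldr (\<otimes>) (map (word_val G) (map (\<lambda>j. concat (replicate (x j) (us j))) [0..<k])) \<one>"
    unfolding blocks_def by (rule word_val_concat) (use assms in fastforce)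
  also have "map (word_val G) (map (\<lambda>j. concat (replicate (x j) (us j))) [0..<k]) = map (\<lambda>j. word_val G (us j) [^] x j) [0..<k]"
    using assms by (simp add: word_val_power)
  finally show ?thesis .
qed

text \<open>Moving the target to the left turns the equation into the triviality of one word. Only
  values enter, so the words \<open>us j\<close> and \<open>z\<close> may use another alphabet than
  the instance.\<close>

lemma knapsack_solvable_iff:
  assumes "\<And>u. u \<in> set vs \<Longrightarrow> set u \<subseteq> carrier G" "set v \<subseteq> carrier G"
    and "\<And>j. j < length vs \<Longrightarrow> set (us j) \<subseteq> carrier G \<and> word_val G (us j) = word_val G (vs ! j)"
    and "set z \<subseteq> carrier G" "word_val G z = inv (word_val G v)"
  shows "knapsack_solvable G vs v \<longleftrightarrow> (\<exists>x. word_val G (z @ blocks us (length vs) x 0) = \<one>)"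
proof -
  let ?pr = "\<lambda>x. foldr (\<otimes>) (map (\<lambda>j. word_val G (us j) [^] x j) [0..<length vs]) \<one>"
  have blocks: "word_val G (blocks us (length vs) x 0) = ?pr x" for x :: "nat \<Rightarrow> nat"
    using assms(3) by (intro word_val_blocks) auto
  have closed: "set (blocks us (length vs) x 0) \<subseteq> carrier G" for x
    using assms(3) unfolding blocks_def by fastforce
  have "word_val G (z @ blocks us (length vs) x 0) = inv (word_val G v) \<otimes> ?pr x" for x :: "nat \<Rightarrow> nat"
    using word_val_append[OF assms(4) closed[of x]] assms(5) blocks by simp
  moreover have "?pr x \<in> carrier G" for x :: "nat \<Rightarrow> nat"
    using word_val_closed[OF closed[of x]] blocks by simp
  ultimately have iff: "word_val G (z @ blocks us (length vs) x 0) = \<one> \<longleftrightarrow> word_val G v = ?pr x" for x :: "nat \<Rightarrow> nat"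
    by (simp only: inv_mult_eq_one_iff word_val_closed[OF assms(2)])
  have list: "map2 (\<lambda>u e. word_val G u [^] e) vs es = map (\<lambda>j. word_val G (us j) [^] (es ! j)) [0..<length vs]"
    if "length es = length vs" for es :: "nat list"
    using that assms(3) by (intro nth_equalityI) auto
  show ?thesis
  proof
    assume "knapsack_solvable G vs v"
    then obtain es :: "nat list" where "length es = length vs" "word_val G v = ?pr ((!) es)"
      unfolding knapsack_solvable_def using list by auto
    then show "\<exists>x. word_val G (z @ blocks us (length vs) x 0) = \<one>" using iff by blast
  next
    assume "\<exists>x. word_val G (z @ blocks us (length vs) x 0) = \<one>"
    then obtain x :: "nat \<Rightarrow> nat" where x: "word_val G v = ?pr x" using iff by blast
    let ?es = "map x [0..<length vs]"
    have "word_val G v = foldr (\<otimes>) (map2 (\<lambda>u e. word_val G u [^] e) vs ?es) \<one>"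
      unfolding x by (subst list) (auto intro!: arg_cong[where f = "\<lambda>l. foldr (\<otimes>) l \<one>"])
    then show "knapsack_solvable G vs v" unfolding knapsack_solvable_def
      by (intro exI[of _ ?es]) simp
  qed
qed

end

lemma blocks_extend:
  assumes "n \<le> k" "\<And>i. n \<le> i \<Longrightarrow> us i = []"
  shows "blocks us k x 0 = blocks us n x 0"
  using assms(1) by (induction rule: dec_induct) (simp_all add: blocks_def assms(2))

lemma blocks_map: "map f (blocks us k x i) = blocks (\<lambda>j. map f (us j)) k x i"
  by (simp add: blocks_def map_concat map_replicate comp_def)

section \<open>Bounded search over exponent vectors and translation of instances\<close>

section \<open>The decision procedure\<close>

lemma decidable_set_dec: "dec P \<Longrightarrow> decidable_set {x. P x}"
proof -
  assume "dec P"
  then obtain g where g: "general_recursive 1 g" "\<And>xs. length xs = 1 \<Longrightarrow> g xs = (if P (xs ! 0) then 1 else 0)"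
    unfolding dec_def rec_def recn_def by blast
  have "g [x] = (if x \<in> {x. P x} then 1 else 0)" for x using g(2)[of "[x]"] by simp
  then show ?thesis using g(1) unfolding decidable_set_def by blast
qed

lemma rec_exponent_bound [rec_intros]:
  "rec f \<Longrightarrow> rec g \<Longrightarrow> rec (\<lambda>x. exponent_bound a \<rho> s (f x) (g x))"
  unfolding exponent_bound_def by (intro rec_intros)

text \<open>Monotonicity of pairing makes the constant list with entries \<open>b\<close> an upper
  bound among lists of the same length; this limits the search over exponent vectors.\<close>

lemma list_encode_bound:
  "\<forall>e\<in>set xs. e \<le> b \<Longrightarrow> list_encode xs \<le> rec_nat 0 (\<lambda>_ r. Suc (prod_encode (b, r))) (length xs)"
  by (induction xs) (auto intro: prod_encode_mono)

text \<open>Beyond the end of an instance \<open>lnth\<close> yields \<open>0\<close>, the code of the empty word. Hence the code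
  \<open>e\<close> itself can serve as the number of blocks.\<close>

definition instance_blocks :: "(nat \<Rightarrow> nat list) \<Rightarrow> nat \<Rightarrow> nat \<Rightarrow> nat list" where
  "instance_blocks \<tau> e i = concat (map \<tau> (list_decode (lnth (pfst e) i)))"

definition instance_target :: "(nat \<Rightarrow> nat list) \<Rightarrow> nat \<Rightarrow> nat list" where
  "instance_target \<tau>' e = concat (map \<tau>' (rev (list_decode (psnd e))))"

lemma length_concat_le: "(\<And>a. length (\<tau> a) \<le> m) \<Longrightarrow> length (concat (map \<tau> w)) \<le> m * length w"
  by (induction w) (auto intro: add_mono)

lemma dec_exists_exponents:
  fixes P :: "(nat, nat) productions"
  assumes P: "finite P" and \<tau>: "recl \<tau>" "recl \<tau>'" and m: "\<And>a. length (\<tau> a) \<le> m" "\<And>a. length (\<tau>' a) \<le> m"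
  shows "dec (\<lambda>e. \<exists>x. instance_target \<tau>' e @ blocks (instance_blocks \<tau> e) e x 0 \<notin> language_of P S)"
proof -
  obtain a \<rho> s where bound: "\<And>us k z L x. (\<And>i. i < k \<Longrightarrow> length (us i) \<le> L) \<Longrightarrow> length z \<le> L \<Longrightarrow>
    z @ blocks us k x 0 \<notin> language_of P S \<Longrightarrow>
    \<exists>y. z @ blocks us k y 0 \<notin> language_of P S \<and> (\<forall>i. y i < exponent_bound a \<rho> s ((k + 1) * ((k + 1) * (L + 1))) k)"
    using exponent_bound[OF P] by metis
  \<comment> \<open>There are \<open>e\<close> blocks. A word in the instance has at most
    \<open>e\<close> letters, since its code is at most \<open>e\<close>, and each letter becomes at
    most \<open>m\<close> letters; hence length at most \<open>m * e\<close>.\<close>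
  define B where "B e = exponent_bound a \<rho> s ((e + 1) * ((e + 1) * (m * e + 1))) e" for e
  \<comment> \<open>A limit for the codes of lists of \<open>e\<close> exponents below
    \<open>B e\<close>.\<close>
  define Y where "Y e = rec_nat 0 (\<lambda>_ r. Suc (prod_encode (B e, r))) e" for e
  have B: "rec B" unfolding B_def by (intro rec_intros)
  have Y: "rec Y" unfolding Y_def by (intro rec_intros rec_comp[OF B])
  have le: "pfst e \<le> e" "psnd e \<le> e" for e
    using le_prod_encode_1[of "pfst e" "psnd e"] le_prod_encode_2[of "psnd e" "pfst e"] by simp_all
  have len: "length (list_decode e) \<le> e" for e
    using length_le_list_encode[of "list_decode e"] by simp
  have lnth_le: "lnth l i \<le> l" for l i
    using mem_le_list_encode[of "list_decode l ! i" "list_decode l"] by (simp add: lnth_eq)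
  have L1: "length (instance_blocks \<tau> e i) \<le> m * e" for e i
    unfolding instance_blocks_def
    by (rule order.trans[OF length_concat_le[OF m(1)] mult_le_mono2])
      (meson len lnth_le le le_trans)
  have L2: "length (instance_target \<tau>' e) \<le> m * e" for e
    unfolding instance_target_def
    by (rule order.trans[OF length_concat_le[OF m(2)] mult_le_mono2])
      (metis len le(2) le_trans length_rev)
  have "(\<exists>x. instance_target \<tau>' e @ blocks (instance_blocks \<tau> e) e x 0 \<notin> language_of P S) \<longleftrightarrow>
    (\<exists>y\<le>Y e. \<not> instance_target \<tau>' e @ blocks (instance_blocks \<tau> e) e (lnth y) 0 \<in> language_of P S)" for e
  proof
    assume "\<exists>x. instance_target \<tau>' e @ blocks (instance_blocks \<tau> e) e x 0 \<notin> language_of P S"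
    then obtain x where x: "instance_target \<tau>' e @ blocks (instance_blocks \<tau> e) e x 0 \<notin> language_of P S" "\<And>i. x i < B e"
      using bound[where us = "instance_blocks \<tau> e" and k = e and z = "instance_target \<tau>' e", OF L1 L2] 
      unfolding B_def by blast
    let ?y = "list_encode (map x [0..<e])"
    have "?y \<le> Y e"
      using list_encode_bound[of "map x [0..<e]" "B e"] x(2) by (auto simp: Y_def less_imp_le)
    moreover have "blocks (instance_blocks \<tau> e) e (lnth ?y) 0 = blocks (instance_blocks \<tau> e) e x 0"
      by (rule blocks_cong) (simp add: lnth_eq)
    ultimately show "\<exists>y\<le>Y e. \<not> instance_target \<tau>' e @ blocks (instance_blocks \<tau> e) e (lnth y) 0 \<in> language_of P S"
      using x(1) by metis
  qed blast
  moreover have "recl (\<lambda>p. instance_target \<tau>' (psnd p) @ blocks (instance_blocks \<tau> (psnd p)) (psnd p) (lnth (pfst p)) 0)"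
    unfolding instance_target_def blocks_def instance_blocks_def
    by (intro rec_intros recl_concat_map recl_concat_upt \<tau>)
  ultimately show ?thesis
    by (simp only:) (intro dec_ex_le dec_not dec_context_free P Y)
qed

theorem theorem8p1:
  fixes G :: "('a, 'b) monoid_scheme"
  assumes "co_context_free_group G"
  shows "decidable_knapsack G"
  unfolding decidable_knapsack_def
proof (intro allI impI)
  fix \<Sigma> and c :: "'a \<Rightarrow> nat"
  assume \<Sigma>: "finite_generating_set G \<Sigma>" and c: "inj_on c (sym_alphabet G \<Sigma>)"
  interpret group G using assms by (simp add: co_context_free_group_def)
  obtain \<Gamma> S and P\<^sub>0 :: "(nat, 'a) productions" where \<Gamma>: "finite_generating_set G \<Gamma>" and P\<^sub>0: "finite P\<^sub>0" "co_word_problem G \<Gamma> = language_of P\<^sub>0 S"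
    using assms unfolding co_context_free_group_def context_free_def by blast
  let ?A = "sym_alphabet G \<Sigma>" and ?B = "sym_alphabet G \<Gamma>"
  have A: "finite ?A" "?A \<subseteq> carrier G" and B: "finite ?B" "?B \<subseteq> carrier G"
    using \<Sigma> \<Gamma> sym_alphabet_carrier by (auto simp: finite_generating_set_def sym_alphabet_def)
  \<comment> \<open>The grammar gets its own numbering of letters, as its alphabet may differ from
    the one that \<open>c\<close> encodes.\<close>
  obtain d :: "'a \<Rightarrow> nat" where d: "inj_on d ?B" using finite_imp_inj_to_nat_seg[OF B(1)] by blast
  define P where "P = map_prod id (map (map_symbol id d)) ` P\<^sub>0"
  have P: "finite P" using P\<^sub>0(1) by (simp add: P_def)
  have L: "language_of P S = map d ` co_word_problem G \<Gamma>"
    unfolding P_def P\<^sub>0(2) by (rule language_of_map)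
  have co_word: "map d w \<in> language_of P S \<longleftrightarrow> word_val G w \<noteq> \<one>\<^bsub>G\<^esub>" if "set w \<subseteq> ?B" for w
  proof -
    have "inj_on (map d) (lists ?B)" by (rule inj_on_mapI, rule inj_on_subset[OF d]) auto
    then have "map d w \<in> map d ` co_word_problem G \<Gamma> \<longleftrightarrow> w \<in> co_word_problem G \<Gamma>"
      using that by (intro inj_on_image_mem_iff[of _ "lists ?B"]) (auto simp: co_word_problem_def)
    then show ?thesis using that L by (auto simp: co_word_problem_def)
  qed
  have "\<exists>w. set w \<subseteq> ?B \<and> word_val G w = g" if "g \<in> carrier G" for g
    using generate_words[of g \<Gamma>] \<Gamma> that by (auto simp: finite_generating_set_def in_lists_conv_set subset_iff)
  \<comment> \<open>Any choice of words will do: the translations apply \<open>t\<close> only to the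
    finitely many letters and their inverses.\<close>
  then obtain t where t: "\<And>g. g \<in> carrier G \<Longrightarrow> set (t g) \<subseteq> ?B \<and> word_val G (t g) = g" by metis
  define decode where "decode = the_inv_into ?A c"
  have decode: "decode (c a) = a" if "a \<in> ?A" for a using the_inv_into_f_f[OF c that] by (simp add: decode_def)
  \<comment> \<open>The value \<open>[]\<close> has code 0, so away from the letter codes the table
    vanishes and has finite support.\<close>
  define \<tau> where "\<tau> n = (if n \<in> c ` ?A then map d (t (decode n)) else [])" for n
  define \<tau>' where "\<tau>' n = (if n \<in> c ` ?A then map d (t (inv\<^bsub>G\<^esub> (decode n))) else [])" for n
  have \<tau>c: "\<tau> (c a) = map d (t a)" "\<tau>' (c a) = map d (t (inv\<^bsub>G\<^esub> a))" if "a \<in> ?A" for a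
    using that decode by (auto simp: \<tau>_def \<tau>'_def)
  have fin: "finite (c ` ?A)" using A by simp
  have \<tau>: "recl \<tau>" "recl \<tau>'" unfolding recl_def
    by (auto intro!: rec_finite_support finite_subset[OF _ fin] simp: \<tau>_def \<tau>'_def split: if_splits)
  define m where "m = (\<Sum>n\<in>c ` ?A. length (\<tau> n) + length (\<tau>' n))"
  have "length (\<tau> n) + length (\<tau>' n) \<le> m" for n
    using member_le_sum[of n "c ` ?A" "\<lambda>n. length (\<tau> n) + length (\<tau>' n)"] fin
    by (cases "n \<in> c ` ?A") (auto simp: m_def \<tau>_def \<tau>'_def)
  then have m: "length (\<tau> n) \<le> m" "length (\<tau>' n) \<le> m" for n by (meson add_leD1 add_leD2)+
  \<comment> \<open>The search also answers for numbers that encode no instance; these must be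
    rejected separately.\<close>
  define valid where "valid e \<longleftrightarrow> (\<forall>u\<in>set (list_decode (pfst e)). \<forall>a\<in>set (list_decode u). a \<in> c ` ?A) \<and>
    (\<forall>a\<in>set (list_decode (psnd e)). a \<in> c ` ?A)" for e
  have "dec valid" unfolding valid_def
    by (intro rec_intros dec_list_all dec_finite fin)
  have solvable: "knapsack_solvable G vs v \<longleftrightarrow> 
      (\<exists>x. instance_target \<tau>' e @ blocks (instance_blocks \<tau> e) e x 0 \<notin> language_of P S)"
    if vs: "vs \<in> lists (lists ?A)" "v \<in> lists ?A" and e: "e = encode_instance c (vs, v)" for vs v e
  proof -
    let ?us = "\<lambda>j. if j < length vs then concat (map t (vs ! j)) else []"
    let ?z = "concat (map (\<lambda>a. t (inv\<^bsub>G\<^esub> a)) (rev v))"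
    have vs': "set (vs ! j) \<subseteq> ?A" if "j < length vs" for j using vs(1) that by (auto simp: in_lists_conv_set subset_iff)
    have vs_carrier: "set u \<subseteq> carrier G" if "u \<in> set vs" for u
    proof -
      have "u \<in> lists ?A" using vs(1) that by (simp add: in_lists_conv_set)
      then show ?thesis using A(2) by (auto simp: in_lists_conv_set)
    qed
    have v': "set (rev v) \<subseteq> ?A" using vs(2) by auto
    have t_B: "set (t a) \<subseteq> ?B" "set (t (inv\<^bsub>G\<^esub> a)) \<subseteq> ?B" if "a \<in> ?A" for a
      using t A(2) that by (meson inv_closed subsetD)+
    have us_B: "set (?us j) \<subseteq> ?B" for j
    proof (cases "j < length vs")
      case True
      then have "set (?us j) = (\<Union>a\<in>set (vs ! j). set (t a))" by simp
      also have "\<dots> \<subseteq> ?B" using t_B(1) vs'[OF True] by blast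
      finally show ?thesis .
    qed simp
    have "set ?z = (\<Union>a\<in>set (rev v). set (t (inv\<^bsub>G\<^esub> a)))" by simp
    also have "\<dots> \<subseteq> ?B" using t_B(2) v' by blast
    finally have z_B: "set ?z \<subseteq> ?B" .
    have e': "list_decode (pfst e) = map (\<lambda>u. list_encode (map c u)) vs" "list_decode (psnd e) = map c v"
      by (simp_all add: e encode_instance_def)
    have "length vs \<le> e"
      using length_le_list_encode[of "list_decode (pfst e)"] le_prod_encode_1[of "pfst e" "psnd e"]
        arg_cong[OF e'(1), of length] by simp
    have "map \<tau> (map c u) = map (map d) (map t u)" if "set u \<subseteq> ?A" for u
      using that \<tau>c by auto
    then have "concat (map \<tau> (map c (vs ! j))) = map d (concat (map t (vs ! j)))" if "j < length vs" for j
      using vs'[OF that] by (simp only: map_concat)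
    then have us_eq: "instance_blocks \<tau> e j = map d (?us j)" for j
      using e'(1) unfolding instance_blocks_def lnth_eq by simp
    have "map \<tau>' (map c (rev v)) = map (map d) (map (\<lambda>a. t (inv\<^bsub>G\<^esub> a)) (rev v))"
      using v' \<tau>c by auto
    then have z_eq: "instance_target \<tau>' e = map d ?z"
      unfolding instance_target_def e'(2) by (simp only: rev_map map_concat)
    have "knapsack_solvable G vs v \<longleftrightarrow> (\<exists>x. word_val G (?z @ blocks ?us (length vs) x 0) = \<one>\<^bsub>G\<^esub>)"
    proof (rule knapsack_solvable_iff)
      show "word_val G ?z = inv\<^bsub>G\<^esub> (word_val G v)"
      proof -
        have "word_val G ?z = word_val G (map (m_inv G) (rev v))"
          by (rule word_val_concat_map[OF v']) (use t A(2) B(2) in blast)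
        then show ?thesis using word_val_inverses[of v] vs(2) A(2) by auto
      qed
      fix j assume j: "j < length vs"
      have "word_val G (concat (map t (vs ! j))) = word_val G (map (\<lambda>a. a) (vs ! j))"
        by (rule word_val_concat_map[OF vs'[OF j]]) (use t A(2) B(2) in blast)
      then show "set (?us j) \<subseteq> carrier G \<and> word_val G (?us j) = word_val G (vs ! j)"
        using us_B[of j] B(2) j by auto
    qed (use vs_carrier vs(2) A(2) z_B B(2) in auto)
    also have "\<dots> \<longleftrightarrow> (\<exists>x. map d (?z @ blocks ?us e x 0) \<notin> language_of P S)"
    proof -
      have "blocks ?us (length vs) x 0 = blocks ?us e x 0" for x
        by (rule blocks_extend[symmetric, OF \<open>length vs \<le> e\<close>]) simp
      moreover have "set (?z @ blocks ?us e x 0) \<subseteq> ?B" for x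
        using us_B z_B by (auto simp: blocks_def)
      note co_word[OF this]
      ultimately show ?thesis by (simp only: not_not)
    qed
    also have "\<dots> \<longleftrightarrow> (\<exists>x. instance_target \<tau>' e @ blocks (instance_blocks \<tau> e) e x 0 \<notin> language_of P S)"
      unfolding map_append blocks_map z_eq us_eq ..
    finally show ?thesis .
  qed
  have "encode_instance c ` knapsack_problem G \<Sigma> = 
    {e. valid e \<and> (\<exists>x. instance_target \<tau>' e @ blocks (instance_blocks \<tau> e) e x 0 \<notin> language_of P S)}"
  proof (intro equalityI subsetI)
    fix e assume "e \<in> encode_instance c ` knapsack_problem G \<Sigma>"
    then obtain vs v where *: "vs \<in> lists (lists ?A)" "v \<in> lists ?A" "knapsack_solvable G vs v" "e = encode_instance c (vs, v)"
      by (auto simp: knapsack_problem_def)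
    moreover have "valid e" using *(1,2) by (auto simp: *(4) valid_def encode_instance_def)
    ultimately show "e \<in> {e. valid e \<and> (\<exists>x. instance_target \<tau>' e @ blocks (instance_blocks \<tau> e) e x 0 \<notin> language_of P S)}"
      using solvable by blast
  next
    fix e assume e: "e \<in> {e. valid e \<and> (\<exists>x. instance_target \<tau>' e @ blocks (instance_blocks \<tau> e) e x 0 \<notin> language_of P S)}"
    have c_decode: "c (decode n) = n" "decode n \<in> ?A" if "n \<in> c ` ?A" for n
      using that decode by auto
    define v where "v = map decode (list_decode (psnd e))"
    define vs where "vs = map (\<lambda>u. map decode (list_decode u)) (list_decode (pfst e))"
    have map_c: "map c (map decode w) = w" if "\<forall>n\<in>set w. n \<in> c ` ?A" for w
      unfolding map_map by (rule map_idI) (use that c_decode in simp)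
    have "map (\<lambda>u. list_encode (map c u)) vs = list_decode (pfst e)"
      unfolding vs_def map_map by (rule map_idI) (use e map_c in \<open>simp add: valid_def del: map_map\<close>)
    moreover have "map c v = list_decode (psnd e)"
      unfolding v_def by (rule map_c) (use e in \<open>simp add: valid_def\<close>)
    ultimately have "encode_instance c (vs, v) = e" by (simp add: encode_instance_def)
    moreover have "vs \<in> lists (lists ?A)" "v \<in> lists ?A"
      using e c_decode by (auto simp: vs_def v_def valid_def)
    ultimately show "e \<in> encode_instance c ` knapsack_problem G \<Sigma>"
      using e solvable by (force simp: knapsack_problem_def)
  qed
  then show "decidable_set (encode_instance c ` knapsack_problem G \<Sigma>)"
    using decidable_set_dec[OF dec_conj[OF \<open>dec valid\<close> dec_exists_exponents[OF P \<tau> m]]] by simp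
qed

end
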